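(* Let $\mathcal{A}^{\mathbb{Z}}$ be any Abelian group shift, let $(\mathcal{A}^{\mathbb{Z}},F)$ be a nontrivial algebraic bipermutative cellular automaton, let $\Sigma$ be a closed $(F,\sigma)$-invariant subgroup of $\mathcal{A}^{\mathbb{Z}}$, let $k\in\mathbb{N}$ be such that every prime factor of $|\mathcal{A}|$ divides $k$, and let $\mu$ be an $(F,\sigma)$-invariant Borel probability measure on $\mathcal{A}^{\mathbb{Z}}$ with $\mathrm{supp}(\mu)\subset\Sigma$. Assume that: 1. $\mu$ is ergodic for $\sigma$; 2. $\mathcal{I}_\mu(\sigma)=\mathcal{I}_\mu(\sigma^{kp_1})$, where $p_1$ is the smallest common $\sigma$-period of all elements of $\mathrm{Ker}(F)$; 3. the measure entropy $h_\mu(F)$ is positive; 4. every $(F,\sigma)$-invariant infinite subgroup of $D^{\Sigma}_\infty(F)=\bigcup_{n\in\mathbb{N}}\mathrm{Ker}(F^n)\cap\Sigma$ is dense in $\Sigma$. Then $\mu=\lambda_\Sigma$, the Haar measure on $\Sigma$.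
   Context: $\mathcal{A}$ is a finite set, $\mathcal{A}^{\mathbb{Z}}$ has the product topology, and $\sigma(x)_i=x_{i+1}$ is the shift. A cellular automaton (CA) $(\mathcal{A}^{\mathbb{Z}},F)$ is a continuous map $F:\mathcal{A}^{\mathbb{Z}}\to\mathcal{A}^{\mathbb{Z}}$ commuting with $\sigma$; equivalently there are a finite interval $\mathbb{U}\subset\mathbb{Z}$ (a neighborhood) and a local rule $\overline{F}:\mathcal{A}^{\mathbb{U}}\to\mathcal{A}$ with $F(x)_m=\overline{F}((x_{m+u})_{u\in\mathbb{U}})$ for all $m$. The smallest such interval is the smallest neighborhood; $F$ is trivial if it is a single point, and nontrivial otherwise. If the smallest neighborhood is $[r,s]$, $F$ is left-permutative if for all $u\in\mathcal{A}^{s-r}$, $b\in\mathcal{A}$ there is a unique $a\in\mathcal{A}$ with $\overline{F}(au)=b$; right-permutative if for all such $u,b$ there is a unique $a$ with $\overline{F}(ua)=b$; bipermutative if both. $\mathcal{A}^{\mathbb{Z}}$ is an Abelian group shift if it is endowed with an Abelian topological group structure (for its product topology; not necessarily a product group structure) for which $\sigma$ is a continuous group endomorphism. A CA $F$ on an Abelian group shift is algebraic if $F$ is a group endomorphism. (For $F$ bipermutative and algebraic, $\mathrm{Ker}(F^n)$ is finite and consists of $\sigma$-periodic points for every $n$.) A subset or subgroup $\Gamma$ is $\sigma$-invariant if $\sigma(\Gamma)=\Gamma$, and $(F,\sigma)$-invariant if moreover $F(\Gamma)\subset\Gamma$. A measure $\mu$ is $(F,\sigma)$-invariant if $\mu(F^{-1}B)=\mu(\sigma^{-1}B)=\mu(B)$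 for all Borel $B$. For a power $\sigma^n$, $\mathcal{I}_\mu(\sigma^n)=\{B \text{ Borel}:\mu(\sigma^{-n}(B)\triangle B)=0\}$. The Haar measure $\lambda_\Sigma$ is viewed as a probability measure on $\mathcal{A}^{\mathbb{Z}}$ supported on $\Sigma$. $h_\mu(F)$ is the Kolmogorov–Sinai entropy of $F$ with respect to $\mu$. *)

theory Defs
  imports
    "HOL-Probability.Probability"
    "HOL-Probability.Discrete_Topology"
    "HOL-Algebra.Coset"
    "HOL-Computational_Algebra.Primes"
begin

text \<open>
  The alphabet is an arbitrary finite type. Wrapping it in the library type \<open>discrete\<close> makes the
  standard topology on functions the product of discrete topologies, so that \<open>continuous_on\<close>,
  \<open>closed\<close>, \<open>closure\<close> and \<open>borel\<close> on configurations have their intended meaning.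
\<close>

type_synonym 'a config = "int \<Rightarrow> 'a discrete"

definition shift_map :: "'a config \<Rightarrow> 'a config" where
  "shift_map x = (\<lambda>i. x (i + 1))"


subsection \<open>Cellular automata\<close>

definition cellular_automaton :: "('a::finite config \<Rightarrow> 'a config) \<Rightarrow> bool" where
  "cellular_automaton F \<longleftrightarrow> continuous_on UNIV F \<and> (\<forall>x. F (shift_map x) = shift_map (F x))"

text \<open>The word \<open>(x\<^sub>m\<^sub>+\<^sub>u)\<close>, \<open>u \<in> [r, s]\<close>, is encoded as a list of length \<open>s - r + 1\<close>.\<close>

definition local_rule ::
  "('a::finite config \<Rightarrow> 'a config) \<Rightarrow> int \<Rightarrow> int \<Rightarrow> ('a discrete list \<Rightarrow> 'a discrete) \<Rightarrow> bool" where
  "local_rule F r s f \<longleftrightarrow> r \<le> s \<and> (\<forall>x m. F x m = f (map (\<lambda>u. x (m + u)) [r..s]))"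

definition neighborhood :: "('a::finite config \<Rightarrow> 'a config) \<Rightarrow> int \<Rightarrow> int \<Rightarrow> bool" where
  "neighborhood F r s \<longleftrightarrow> (\<exists>f. local_rule F r s f)"

text \<open>
  Neighborhoods are nonempty intervals. Every non-constant cellular automaton has a unique smallest
  one; a constant map has none, and is neither left- nor right-permutative below.
\<close>

definition smallest_neighborhood :: "('a::finite config \<Rightarrow> 'a config) \<Rightarrow> int \<Rightarrow> int \<Rightarrow> bool" where
  "smallest_neighborhood F r s \<longleftrightarrow>
     neighborhood F r s \<and> (\<forall>r' s'. neighborhood F r' s' \<longrightarrow> {r..s} \<subseteq> {r'..s'})"

definition trivial_CA :: "('a::finite config \<Rightarrow> 'a config) \<Rightarrow> bool" where
  "trivial_CA F \<longleftrightarrow> (\<exists>r. smallest_neighborhood F r r)"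

definition left_permutative :: "('a::finite config \<Rightarrow> 'a config) \<Rightarrow> bool" where
  "left_permutative F \<longleftrightarrow>
     (\<exists>r s f. smallest_neighborhood F r s \<and> local_rule F r s f \<and>
        (\<forall>u b. length u = nat (s - r) \<longrightarrow> (\<exists>!a. f (a # u) = b)))"

definition right_permutative :: "('a::finite config \<Rightarrow> 'a config) \<Rightarrow> bool" where
  "right_permutative F \<longleftrightarrow>
     (\<exists>r s f. smallest_neighborhood F r s \<and> local_rule F r s f \<and>
        (\<forall>u b. length u = nat (s - r) \<longrightarrow> (\<exists>!a. f (u @ [a]) = b)))"

definition bipermutative :: "('a::finite config \<Rightarrow> 'a config) \<Rightarrow> bool" where
  "bipermutative F \<longleftrightarrow> left_permutative F \<and> right_permutative F"


subsection \<open>Abelian group shifts\<close>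

definition abelian_group_shift :: "'a::finite config monoid \<Rightarrow> bool" where
  "abelian_group_shift G \<longleftrightarrow>
     comm_group G \<and> carrier G = UNIV \<and>
     continuous_on UNIV (\<lambda>(x, y). x \<otimes>\<^bsub>G\<^esub> y) \<and>
     continuous_on UNIV (\<lambda>x. inv\<^bsub>G\<^esub> x) \<and>
     continuous_on UNIV (shift_map :: 'a config \<Rightarrow> 'a config) \<and> shift_map \<in> hom G G"

definition algebraic_CA :: "'a::finite config monoid \<Rightarrow> ('a config \<Rightarrow> 'a config) \<Rightarrow> bool" where
  "algebraic_CA G F \<longleftrightarrow> cellular_automaton F \<and> F \<in> hom G G"

definition invariant_set :: "('a::finite config \<Rightarrow> 'a config) \<Rightarrow> 'a config set \<Rightarrow> bool" where
  "invariant_set F \<Gamma> \<longleftrightarrow> shift_map ` \<Gamma> = \<Gamma> \<and> F ` \<Gamma> \<subseteq> \<Gamma>"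

definition D_infty ::
  "'a::finite config monoid \<Rightarrow> ('a config \<Rightarrow> 'a config) \<Rightarrow> 'a config set \<Rightarrow> 'a config set" where
  "D_infty G F \<Sigma> = (\<Union>n. kernel G G (F ^^ n)) \<inter> \<Sigma>"

text \<open>
  The set of common periods is nonempty whenever the kernel is finite and consists of periodic
  points, in particular for bipermutative algebraic \<open>F\<close>.
\<close>

definition kernel_period :: "'a::finite config monoid \<Rightarrow> ('a config \<Rightarrow> 'a config) \<Rightarrow> nat" where
  "kernel_period G F = (LEAST p. 0 < p \<and> (\<forall>x\<in>kernel G G F. (shift_map ^^ p) x = x))"


subsection \<open>Measures\<close>

definition borel_probability :: "'b::topological_space measure \<Rightarrow> bool" where
  "borel_probability M \<longleftrightarrow> prob_space M \<and> sets M = sets borel"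

definition invariant_measure :: "'b measure \<Rightarrow> ('b \<Rightarrow> 'b) \<Rightarrow> bool" where
  "invariant_measure M T \<longleftrightarrow> (\<forall>B\<in>sets M. emeasure M (T -` B \<inter> space M) = emeasure M B)"

definition measure_support :: "'b::topological_space measure \<Rightarrow> 'b set" where
  "measure_support M = {x. \<forall>U. open U \<and> x \<in> U \<longrightarrow> emeasure M U > 0}"

definition ergodic :: "'b measure \<Rightarrow> ('b \<Rightarrow> 'b) \<Rightarrow> bool" where
  "ergodic M T \<longleftrightarrow>
     (\<forall>B\<in>sets M. T -` B \<inter> space M = B \<longrightarrow> emeasure M B = 0 \<or> emeasure M B = 1)"

definition invariant_sets_mod :: "'b measure \<Rightarrow> ('b \<Rightarrow> 'b) \<Rightarrow> 'b set set" where
  "invariant_sets_mod M T = {B \<in> sets M. emeasure M (sym_diff (T -` B \<inter> space M) B) = 0}"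

text \<open>The Haar measure on a closed subgroup, as a Borel probability measure on the whole space.\<close>

definition is_haar_measure ::
  "'a::finite config monoid \<Rightarrow> 'a config set \<Rightarrow> 'a config measure \<Rightarrow> bool" where
  "is_haar_measure G \<Sigma> M \<longleftrightarrow>
     borel_probability M \<and> emeasure M \<Sigma> = 1 \<and>
     (\<forall>g\<in>\<Sigma>. \<forall>B\<in>sets borel. B \<subseteq> \<Sigma> \<longrightarrow> emeasure M ((\<lambda>x. g \<otimes>\<^bsub>G\<^esub> x) ` B) = emeasure M B)"

definition haar_measure :: "'a::finite config monoid \<Rightarrow> 'a config set \<Rightarrow> 'a config measure" where
  "haar_measure G \<Sigma> = (THE M. is_haar_measure G \<Sigma> M)"


subsection \<open>Kolmogorov--Sinai entropy\<close>

definition finite_partition :: "'b measure \<Rightarrow> 'b set set \<Rightarrow> bool" where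
  "finite_partition M P \<longleftrightarrow> finite P \<and> P \<subseteq> sets M \<and> partition_on (space M) P"

text \<open>The convention \<open>0 ln 0 = 0\<close> holds because \<open>ln 0 = 0\<close> in the library.\<close>

definition partition_entropy :: "'b measure \<Rightarrow> 'b set set \<Rightarrow> real" where
  "partition_entropy M P = - (\<Sum>A\<in>P. measure M A * ln (measure M A))"

definition preimage_partition :: "'b measure \<Rightarrow> ('b \<Rightarrow> 'b) \<Rightarrow> 'b set set \<Rightarrow> 'b set set" where
  "preimage_partition M T P = (\<lambda>A. T -` A \<inter> space M) ` P - {{}}"

text \<open>The join of \<open>T\<^sup>-\<^sup>i P\<close> over \<open>i < n\<close>.\<close>

definition iterated_partition ::
  "'b measure \<Rightarrow> ('b \<Rightarrow> 'b) \<Rightarrow> 'b set set \<Rightarrow> nat \<Rightarrow> 'b set set" where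
  "iterated_partition M T P n =
     common_refinement ((\<lambda>i. preimage_partition M (T ^^ i) P) ` {..<n})"

text \<open>The limit exists, by subadditivity, whenever \<open>T\<close> is measurable and preserves \<open>M\<close>.\<close>

definition entropy_wrt_partition :: "'b measure \<Rightarrow> ('b \<Rightarrow> 'b) \<Rightarrow> 'b set set \<Rightarrow> real" where
  "entropy_wrt_partition M T P =
     lim (\<lambda>n. partition_entropy M (iterated_partition M T P n) / real n)"

definition KS_entropy :: "'b measure \<Rightarrow> ('b \<Rightarrow> 'b) \<Rightarrow> ereal" where
  "KS_entropy M T = (SUP P\<in>{P. finite_partition M P}. ereal (entropy_wrt_partition M T P))"

end

theory Submission
  imports Defs "HOL-Algebra.Multiplicative_Group" "HOL-Real_Asymp.Real_Asymp"
begin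

text \<open>
  Let \<open>T\<^sub>d\<close> be translation by \<open>d \<in> Ker (F\<^sup>n)\<close>. Some power of the shift fixes \<open>Ker (F\<^sup>n)\<close> pointwise and
  hence commutes with \<open>T\<^sub>d\<close>; its exponent only involves primes dividing \<open>k p\<^sub>1\<close>, so \<open>\<mu>\<close> is ergodic for
  this power. Therefore \<open>T\<^sub>d \<mu>\<close> is either equal to \<open>\<mu>\<close> or singular to it. The elements with
  \<open>T\<^sub>d \<mu> = \<mu>\<close> form an invariant subgroup \<open>H\<close> of \<open>D\<^sub>\<infinity>\<close>. If \<open>H\<close> is infinite, it is dense in \<open>\<Sigma>\<close> and \<open>\<mu>\<close> is the Haar
  measure. If \<open>H\<close> is finite, it lies in some \<open>Ker (F\<^sup>n)\<close>, and singularity of the other translates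
  makes the fibres of \<open>F\<^sup>n\<^sup>+\<^sup>1\<close> and \<open>F\<^sup>n\<close> agree off a null set, so that \<open>F\<close> is injective modulo \<open>\<mu>\<close>.
  Then a coordinate of \<open>x\<close> is almost determined by a long window of \<open>F x\<close>. By bipermutativity the
  entropies of windows of \<open>x\<close> grow sublinearly, which forces \<open>h\<^sub>\<mu>(F) = 0\<close>.
\<close>

section \<open>Entropy of finitely valued maps\<close>

text \<open>Hypothesis 2 speaks of the single power k p1 of the shift, whereas translations by all
  of \<open>D_infty\<close> call for the powers p1 q^n for every n, where q is the order of Ker F.
  Bipermutativity gives q = |A|^(s - r): a point of a fibre of \<open>F\<close> is free on s - r
  consecutive cells and determined by them. Hence the primes dividing p1 q^n divide k p1, although
  p1 q^n itself may not, and ergodicity of a power is proved from its prime factors alone.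

  The dichotomy between equality and singularity concerns two ergodic measures of one invertible
  map; commuting with the chosen power is what makes a translate of \<mu> ergodic for it. Since each
  kernel is finite, finitely many null sets remove all its singular translations at once, and this
  turns singularity into injectivity.

  In the entropy argument any finite-valued map is approximated by one that sees a finite window,
  and n iterates of \<open>F\<close> see only a window of length linear in n. So sublinear growth of
  window entropies bounds the entropy of every partition by 0.\<close>

definition ent :: "'b measure \<Rightarrow> ('b \<Rightarrow> 'c) \<Rightarrow> real" where
  "ent M X = (\<Sum>v\<in>X ` space M.
     - (measure M (X -` {v} \<inter> space M) * ln (measure M (X -` {v} \<inter> space M))))"

text \<open>A difference of joint entropies instead of an average over the values of
  \<open>Y\<close>: the chain rule becomes definitional, and later bounds reduce to monotonicity and
  submodularity of \<open>ent\<close>. Joins of partitions are pairs or lists of maps.\<close>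

definition cond_ent :: "'b measure \<Rightarrow> ('b \<Rightarrow> 'c) \<Rightarrow> ('b \<Rightarrow> 'd) \<Rightarrow> real" where
  "cond_ent M X Y = ent M (\<lambda>\<omega>. (X \<omega>, Y \<omega>)) - ent M Y"

text \<open>This is nonnegativity of conditional mutual information. Apply ln t \<le> t - 1 to t = u
  v / (p w): each summand is at least p - u v / w, and for every z these lower bounds add up to w -
  w w / w = 0.\<close>

lemma sum_ln_submodular:
  fixes p :: "'x \<Rightarrow> 'y \<Rightarrow> 'z \<Rightarrow> real"
  assumes fin: "finite A" "finite B" "finite C"
    and nn: "\<And>x y z. 0 \<le> p x y z"
    and u: "\<And>x z. x \<in> A \<Longrightarrow> z \<in> C \<Longrightarrow> u x z = (\<Sum>y\<in>B. p x y z)"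
    and v: "\<And>y z. y \<in> B \<Longrightarrow> z \<in> C \<Longrightarrow> v y z = (\<Sum>x\<in>A. p x y z)"
    and w: "\<And>z. z \<in> C \<Longrightarrow> w z = (\<Sum>x\<in>A. \<Sum>y\<in>B. p x y z)"
  shows "(\<Sum>x\<in>A. \<Sum>z\<in>C. u x z * ln (u x z)) + (\<Sum>y\<in>B. \<Sum>z\<in>C. v y z * ln (v y z))
       \<le> (\<Sum>x\<in>A. \<Sum>y\<in>B. \<Sum>z\<in>C. p x y z * ln (p x y z)) + (\<Sum>z\<in>C. w z * ln (w z))"
proof -
  have u0: "u x z \<ge> 0" if "x \<in> A" "z \<in> C" for x z using that nn by (simp add: u sum_nonneg)
  have v0: "v y z \<ge> 0" if "y \<in> B" "z \<in> C" for y z using that nn by (simp add: v sum_nonneg)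
  have w0: "w z \<ge> 0" if "z \<in> C" for z using that nn by (simp add: w sum_nonneg)
  have term_le: "p x y z - u x z * v y z / w z
      \<le> p x y z * (ln (p x y z) + ln (w z) - ln (u x z) - ln (v y z))"
    if xyz: "x \<in> A" "y \<in> B" "z \<in> C" for x y z
  proof (cases "p x y z = 0")
    case True
    then show ?thesis using u0 v0 w0 xyz by simp
  next
    case False
    then have p: "p x y z > 0" using nn[of x y z] by simp
    have "p x y z \<le> u x z" using xyz nn fin by (simp add: u member_le_sum[of y B "\<lambda>y. p x y z"])
    then have up: "u x z > 0" using p by simp
    have "p x y z \<le> v y z" using xyz nn fin by (simp add: v member_le_sum[of x A "\<lambda>x. p x y z"])
    then have vp: "v y z > 0" using p by simp
    have "u x z \<le> w z" using xyz nn fin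
      by (simp add: u w member_le_sum[of x A "\<lambda>x. \<Sum>y\<in>B. p x y z"] sum_nonneg)
    then have wp: "w z > 0" using up by simp
    define t where "t = u x z * v y z / (p x y z * w z)"
    have tp: "t > 0" using p up vp wp by (simp add: t_def)
    have "ln t = ln (u x z) + ln (v y z) - ln (p x y z) - ln (w z)"
      using p up vp wp by (simp add: t_def ln_div ln_mult)
    moreover have "ln t \<le> t - 1" using tp by (rule ln_le_minus_one)
    ultimately have "1 - t \<le> ln (p x y z) + ln (w z) - ln (u x z) - ln (v y z)" by simp
    then have "p x y z * (1 - t) \<le> p x y z * (ln (p x y z) + ln (w z) - ln (u x z) - ln (v y z))"
      using p by (intro mult_left_mono) auto
    moreover have "p x y z * (1 - t) = p x y z - u x z * v y z / w z"
      using p wp by (simp add: t_def field_simps)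
    ultimately show ?thesis by simp
  qed
  have su: "(\<Sum>x\<in>A. u x z) = w z" if "z \<in> C" for z using that by (simp add: u w)
  have sv: "(\<Sum>y\<in>B. v y z) = w z" if "z \<in> C" for z
    using that by (simp add: v w) (rule sum.swap)
  have zero: "(\<Sum>z\<in>C. \<Sum>x\<in>A. \<Sum>y\<in>B. p x y z - u x z * v y z / w z) = 0"
  proof (rule sum.neutral, rule ballI)
    fix z assume z: "z \<in> C"
    have "(\<Sum>x\<in>A. \<Sum>y\<in>B. u x z * v y z / w z) = (\<Sum>x\<in>A. u x z) * (\<Sum>y\<in>B. v y z) / w z"
      by (simp add: sum_product sum_divide_distrib)
    also have "\<dots> = w z" using z by (simp add: su sv)
    finally show "(\<Sum>x\<in>A. \<Sum>y\<in>B. p x y z - u x z * v y z / w z) = 0"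
      using z by (simp add: sum_subtractf w)
  qed
  have "0 \<le> (\<Sum>z\<in>C. \<Sum>x\<in>A. \<Sum>y\<in>B.
       p x y z * (ln (p x y z) + ln (w z) - ln (u x z) - ln (v y z)))"
    unfolding zero[symmetric] by (intro sum_mono term_le)
  also have "\<dots> = (\<Sum>z\<in>C. \<Sum>x\<in>A. \<Sum>y\<in>B. p x y z * ln (p x y z))
     + (\<Sum>z\<in>C. \<Sum>x\<in>A. \<Sum>y\<in>B. p x y z * ln (w z))
     - (\<Sum>z\<in>C. \<Sum>x\<in>A. \<Sum>y\<in>B. p x y z * ln (u x z))
     - (\<Sum>z\<in>C. \<Sum>x\<in>A. \<Sum>y\<in>B. p x y z * ln (v y z))"
    by (simp add: ring_distribs sum.distrib sum_subtractf)
  also have "(\<Sum>z\<in>C. \<Sum>x\<in>A. \<Sum>y\<in>B. p x y z * ln (p x y z)) =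
      (\<Sum>x\<in>A. \<Sum>y\<in>B. \<Sum>z\<in>C. p x y z * ln (p x y z))"
    by (subst sum.swap) (intro sum.cong refl sum.swap)
  also have "(\<Sum>z\<in>C. \<Sum>x\<in>A. \<Sum>y\<in>B. p x y z * ln (w z)) = (\<Sum>z\<in>C. w z * ln (w z))"
    by (intro sum.cong refl) (simp add: w sum_distrib_right)
  also have "(\<Sum>z\<in>C. \<Sum>x\<in>A. \<Sum>y\<in>B. p x y z * ln (u x z)) = (\<Sum>x\<in>A. \<Sum>z\<in>C. u x z * ln (u x z))"
    by (subst sum.swap) (intro sum.cong refl, simp add: u sum_distrib_right)
  also have "(\<Sum>z\<in>C. \<Sum>x\<in>A. \<Sum>y\<in>B. p x y z * ln (v y z)) = (\<Sum>y\<in>B. \<Sum>z\<in>C. v y z * ln (v y z))"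
    by (subst (2) sum.swap, subst sum.swap) (intro sum.cong refl, simp add: v sum_distrib_right)
  finally show ?thesis by simp
qed

context prob_space
begin

lemma ent_superset:
  assumes "finite V" "X ` space M \<subseteq> V"
  shows "ent M X = (\<Sum>v\<in>V. - (prob (X -` {v} \<inter> space M) * ln (prob (X -` {v} \<inter> space M))))"
  unfolding ent_def
proof (rule sum.mono_neutral_left[OF assms], rule ballI)
  fix v assume "v \<in> V - X ` space M"
  then have "X -` {v} \<inter> space M = {}" by auto
  then show "- (prob (X -` {v} \<inter> space M) * ln (prob (X -` {v} \<inter> space M))) = 0" by simp
qed

text \<open>Entropy sees only the partition into fibres, since equal fibres induce a bijection
  \<open>g\<close> between the values. So joint maps can be regrouped, and determined components
  added or dropped.\<close>

lemma ent_cong: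
  assumes "\<And>\<omega> \<omega>'. \<omega> \<in> space M \<Longrightarrow> \<omega>' \<in> space M \<Longrightarrow> X \<omega> = X \<omega>' \<longleftrightarrow> Y \<omega> = Y \<omega>'"
  shows "ent M X = ent M Y"
proof -
  define g where "g v = Y (SOME \<omega>. \<omega> \<in> space M \<and> X \<omega> = v)" for v
  have g: "g (X \<omega>) = Y \<omega>" if "\<omega> \<in> space M" for \<omega>
  proof -
    have "(SOME \<omega>'. \<omega>' \<in> space M \<and> X \<omega>' = X \<omega>) \<in> space M \<and> X (SOME \<omega>'. \<omega>' \<in> space M \<and> X \<omega>' = X \<omega>) = X \<omega>"
      by (rule someI[of _ \<omega>]) (use that in auto)
    then show ?thesis unfolding g_def using assms that by blast
  qed
  have inj: "inj_on g (X ` space M)"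
    using assms g by (auto simp: inj_on_def)
  have im: "Y ` space M = g ` (X ` space M)" using g by (auto simp: image_iff)
  show ?thesis unfolding ent_def im
  proof (subst sum.reindex[OF inj], intro sum.cong refl)
    fix v assume "v \<in> X ` space M"
    then have "Y -` {g v} \<inter> space M = X -` {v} \<inter> space M" using assms g by auto
    then show "- (prob (X -` {v} \<inter> space M) * ln (prob (X -` {v} \<inter> space M))) =
      ((\<lambda>v. - (prob (Y -` {v} \<inter> space M) * ln (prob (Y -` {v} \<inter> space M)))) \<circ> g) v"
      by simp
  qed
qed

lemma prob_sum_fibres:
  assumes X: "simple_function M X" and A: "A \<in> sets M"
  shows "prob A = (\<Sum>v\<in>X ` space M. prob (A \<inter> (X -` {v} \<inter> space M)))"
proof -
  have fin: "finite (X ` space M)" using X by (rule simple_functionD)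
  have "A = (\<Union>v\<in>X ` space M. A \<inter> (X -` {v} \<inter> space M))"
    using sets.sets_into_space[OF A] by auto
  moreover have "prob (\<Union>v\<in>X ` space M. A \<inter> (X -` {v} \<inter> space M))
     = (\<Sum>v\<in>X ` space M. prob (A \<inter> (X -` {v} \<inter> space M)))"
    by (rule finite_measure_finite_Union[OF fin])
      (use A simple_functionD(2)[OF X] in \<open>auto simp: disjoint_family_on_def\<close>)
  ultimately show ?thesis by simp
qed

lemma ent_submodular:
  assumes X: "simple_function M X" and Y: "simple_function M Y" and Z: "simple_function M Z"
  shows "ent M (\<lambda>\<omega>. (X \<omega>, Y \<omega>, Z \<omega>)) + ent M Z
       \<le> ent M (\<lambda>\<omega>. (X \<omega>, Z \<omega>)) + ent M (\<lambda>\<omega>. (Y \<omega>, Z \<omega>))"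
proof -
  let ?A = "X ` space M" and ?B = "Y ` space M" and ?C = "Z ` space M"
  have fin: "finite ?A" "finite ?B" "finite ?C" using X Y Z by (auto dest: simple_functionD)
  define p where "p x y z = prob ((\<lambda>\<omega>. (X \<omega>, Y \<omega>, Z \<omega>)) -` {(x, y, z)} \<inter> space M)" for x y z
  define u where "u x z = prob ((\<lambda>\<omega>. (X \<omega>, Z \<omega>)) -` {(x, z)} \<inter> space M)" for x z
  define v where "v y z = prob ((\<lambda>\<omega>. (Y \<omega>, Z \<omega>)) -` {(y, z)} \<inter> space M)" for y z
  define w where "w z = prob (Z -` {z} \<inter> space M)" for z
  note s = X Y Z simple_function_Pair[OF X Z] simple_function_Pair[OF Y Z]
    simple_function_Pair[OF X simple_function_Pair[OF Y Z]]
  have u: "u x z = (\<Sum>y\<in>?B. p x y z)" for x z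
    unfolding u_def p_def
    by (subst prob_sum_fibres[OF Y simple_functionD(2)[OF s(4)]])
      (intro sum.cong refl arg_cong[where f = prob], auto)
  have v: "v y z = (\<Sum>x\<in>?A. p x y z)" for y z
    unfolding v_def p_def
    by (subst prob_sum_fibres[OF X simple_functionD(2)[OF s(5)]])
      (intro sum.cong refl arg_cong[where f = prob], auto)
  have w: "w z = (\<Sum>x\<in>?A. \<Sum>y\<in>?B. p x y z)" for z
    unfolding u[symmetric] unfolding u_def w_def
    by (subst prob_sum_fibres[OF X simple_functionD(2)[OF s(3)]])
      (intro sum.cong refl arg_cong[where f = prob], auto)
  have 1: "ent M (\<lambda>\<omega>. (X \<omega>, Y \<omega>, Z \<omega>)) = - (\<Sum>x\<in>?A. \<Sum>y\<in>?B. \<Sum>z\<in>?C. p x y z * ln (p x y z))"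
    by (subst ent_superset[of "?A \<times> ?B \<times> ?C"])
      (use fin in \<open>auto simp: p_def sum.cartesian_product sum_negf intro!: sum.cong\<close>)
  have 2: "ent M (\<lambda>\<omega>. (X \<omega>, Z \<omega>)) = - (\<Sum>x\<in>?A. \<Sum>z\<in>?C. u x z * ln (u x z))"
    by (subst ent_superset[of "?A \<times> ?C"])
      (use fin in \<open>auto simp: u_def sum.cartesian_product sum_negf intro!: sum.cong\<close>)
  have 3: "ent M (\<lambda>\<omega>. (Y \<omega>, Z \<omega>)) = - (\<Sum>y\<in>?B. \<Sum>z\<in>?C. v y z * ln (v y z))"
    by (subst ent_superset[of "?B \<times> ?C"])
      (use fin in \<open>auto simp: v_def sum.cartesian_product sum_negf intro!: sum.cong\<close>)
  have 4: "ent M Z = - (\<Sum>z\<in>?C. w z * ln (w z))"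
    by (simp add: ent_def w_def sum_negf)
  show ?thesis
    using sum_ln_submodular[OF fin, of p u v w] unfolding 1 2 3 4
    by (simp add: u v w p_def)
qed

lemma ent_nonneg: "0 \<le> ent M X"
  unfolding ent_def
proof (intro sum_nonneg)
  fix v
  show "0 \<le> - (prob (X -` {v} \<inter> space M) * ln (prob (X -` {v} \<inter> space M)))"
    by (cases "prob (X -` {v} \<inter> space M) = 0")
      (auto simp: zero_less_measure_iff mult_nonneg_nonpos)
qed

text \<open>Refining the fibres splits each mass \<open>v y\<close> into pieces
  \<open>p x y\<close>, each at most \<open>v y\<close>, and - ln is decreasing. The pair of
  \<open>X\<close> and \<open>Y\<close> has the fibres of \<open>X\<close>.\<close>

lemma ent_mono:
  assumes X: "simple_function M X" and Y: "simple_function M Y"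
    and det: "\<And>\<omega> \<omega>'. \<omega> \<in> space M \<Longrightarrow> \<omega>' \<in> space M \<Longrightarrow> X \<omega> = X \<omega>' \<Longrightarrow> Y \<omega> = Y \<omega>'"
  shows "ent M Y \<le> ent M X"
proof -
  let ?A = "X ` space M" and ?B = "Y ` space M"
  have fin: "finite ?A" "finite ?B" using X Y by (auto dest: simple_functionD)
  define p where "p x y = prob ((\<lambda>\<omega>. (X \<omega>, Y \<omega>)) -` {(x, y)} \<inter> space M)" for x y
  define v where "v y = prob (Y -` {y} \<inter> space M)" for y
  have v: "v y = (\<Sum>x\<in>?A. p x y)" for y
    unfolding v_def p_def
    by (subst prob_sum_fibres[OF X simple_functionD(2)[OF Y]])
      (intro sum.cong refl arg_cong[where f = prob], auto)
  have "ent M Y = (\<Sum>y\<in>?B. \<Sum>x\<in>?A. - (p x y * ln (v y)))"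
    by (simp add: ent_def v_def[symmetric] sum_negf sum_distrib_right[symmetric] v[symmetric])
  also have "\<dots> \<le> (\<Sum>y\<in>?B. \<Sum>x\<in>?A. - (p x y * ln (p x y)))"
  proof (intro sum_mono)
    fix x y assume "x \<in> ?A" "y \<in> ?B"
    then have "p x y \<le> v y" unfolding v using fin by (intro member_le_sum) (auto simp: p_def)
    moreover have "p x y \<ge> 0" by (simp add: p_def)
    ultimately show "- (p x y * ln (v y)) \<le> - (p x y * ln (p x y))"
      by (cases "p x y = 0") (auto intro!: mult_left_mono ln_mono)
  qed
  also have "\<dots> = ent M (\<lambda>\<omega>. (X \<omega>, Y \<omega>))"
    by (subst sum.swap, subst ent_superset[of "?A \<times> ?B"])
      (use fin in \<open>auto simp: p_def sum.cartesian_product intro!: sum.cong\<close>)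
  also have "\<dots> = ent M X" by (rule ent_cong, unfold prod.inject, use det in blast)
  finally show ?thesis .
qed

text \<open>Conditioning on more information: as \<open>Y\<close> determines \<open>Z\<close>,
  adjoining \<open>Z\<close> to \<open>Y\<close> changes no entropy, and submodularity becomes the
  claim.\<close>

lemma cond_ent_mono:
  assumes X: "simple_function M X" and Y: "simple_function M Y" and Z: "simple_function M Z"
    and det: "\<And>\<omega> \<omega>'. \<omega> \<in> space M \<Longrightarrow> \<omega>' \<in> space M \<Longrightarrow> Y \<omega> = Y \<omega>' \<Longrightarrow> Z \<omega> = Z \<omega>'"
  shows "cond_ent M X Y \<le> cond_ent M X Z"
proof -
  have "ent M (\<lambda>\<omega>. (X \<omega>, Y \<omega>, Z \<omega>)) = ent M (\<lambda>\<omega>. (X \<omega>, Y \<omega>))"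
    by (rule ent_cong) (use det in blast)
  moreover have "ent M (\<lambda>\<omega>. (Y \<omega>, Z \<omega>)) = ent M Y"
    by (rule ent_cong) (use det in blast)
  ultimately show ?thesis using ent_submodular[OF X Y Z] by (simp add: cond_ent_def)
qed

lemma cond_ent_Pair_le:
  assumes X: "simple_function M X" and Y: "simple_function M Y" and Z: "simple_function M Z"
  shows "cond_ent M (\<lambda>\<omega>. (X \<omega>, Y \<omega>)) Z \<le> cond_ent M X Z + cond_ent M Y Z"
proof -
  have "ent M (\<lambda>\<omega>. ((X \<omega>, Y \<omega>), Z \<omega>)) = ent M (\<lambda>\<omega>. (X \<omega>, Y \<omega>, Z \<omega>))"
    by (rule ent_cong) auto
  then show ?thesis using ent_submodular[OF X Y Z] by (simp add: cond_ent_def)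
qed

lemma cond_ent_le_of_determined:
  assumes X: "simple_function M X" and Y: "simple_function M Y" and Z: "simple_function M Z"
    and det: "\<And>\<omega> \<omega>'. \<omega> \<in> space M \<Longrightarrow> \<omega>' \<in> space M \<Longrightarrow> X \<omega> = X \<omega>' \<Longrightarrow> Z \<omega> = Z \<omega>' \<Longrightarrow> Y \<omega> = Y \<omega>'"
  shows "cond_ent M Y Z \<le> cond_ent M X Z"
proof -
  have "ent M (\<lambda>\<omega>. (Y \<omega>, Z \<omega>)) \<le> ent M (\<lambda>\<omega>. (X \<omega>, Z \<omega>))"
    by (rule ent_mono) (use X Y Z det in \<open>blast intro: simple_function_Pair\<close>)+
  then show ?thesis by (simp add: cond_ent_def)
qed

lemma simple_function_map:
  assumes "\<And>i. i \<in> set is \<Longrightarrow> simple_function M (X i)"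
  shows "simple_function M (\<lambda>\<omega>. map (\<lambda>i. X i \<omega>) is)"
  using assms
proof (induction "is")
  case (Cons i "is")
  have "simple_function M ((\<lambda>(a, b). a # b) \<circ> (\<lambda>\<omega>. (X i \<omega>, map (\<lambda>i. X i \<omega>) is)))"
    by (intro simple_function_compose simple_function_Pair) (use Cons in auto)
  then show ?case by (simp add: comp_def)
qed simp

lemma cond_ent_map_le:
  assumes X: "\<And>i. i \<in> set is \<Longrightarrow> simple_function M (X i)" and Y: "simple_function M Y"
  shows "cond_ent M (\<lambda>\<omega>. map (\<lambda>i. X i \<omega>) is) Y \<le> (\<Sum>i\<leftarrow>is. cond_ent M (X i) Y)"
  using X
proof (induction "is")
  case Nil
  have "ent M (\<lambda>\<omega>. ([] :: 'c list, Y \<omega>)) = ent M Y" by (rule ent_cong) auto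
  then show ?case by (simp add: cond_ent_def)
next
  case (Cons i "is")
  have s: "simple_function M (\<lambda>\<omega>. map (\<lambda>i. X i \<omega>) is)"
    by (rule simple_function_map) (use Cons in auto)
  have "ent M (\<lambda>\<omega>. (map (\<lambda>i. X i \<omega>) (i # is), Y \<omega>)) =
    ent M (\<lambda>\<omega>. ((X i \<omega>, map (\<lambda>i. X i \<omega>) is), Y \<omega>))"
    by (rule ent_cong) auto
  then have "cond_ent M (\<lambda>\<omega>. map (\<lambda>i. X i \<omega>) (i # is)) Y
     = cond_ent M (\<lambda>\<omega>. (X i \<omega>, map (\<lambda>i. X i \<omega>) is)) Y"
    by (simp add: cond_ent_def)
  also have "\<dots> \<le> cond_ent M (X i) Y + cond_ent M (\<lambda>\<omega>. map (\<lambda>i. X i \<omega>) is) Y"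
    by (rule cond_ent_Pair_le) (use Cons s Y in auto)
  also have "\<dots> \<le> cond_ent M (X i) Y + (\<Sum>i\<leftarrow>is. cond_ent M (X i) Y)"
    using Cons by simp
  finally show ?case by simp
qed

lemma simple_function_mem: "B \<in> sets M \<Longrightarrow> simple_function M (\<lambda>\<omega>. \<omega> \<in> B)"
  by (auto simp: simple_function_def vimage_def Int_def conj_commute
      intro: finite_subset[of _ UNIV])

lemma ent_mem: 
  assumes "B \<in> sets M"
  shows "ent M (\<lambda>\<omega>. \<omega> \<in> B) = - (prob B * ln (prob B)) - ((1 - prob B) * ln (1 - prob B))"
proof -
  have "(\<lambda>\<omega>. \<omega> \<in> B) -` {True} \<inter> space M = B" "(\<lambda>\<omega>. \<omega> \<in> B) -` {False} \<inter> space M = space M - B"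
    using sets.sets_into_space[OF assms] by auto
  then show ?thesis
    by (subst ent_superset[of UNIV]) (auto simp: UNIV_bool prob_compl assms)
qed

text \<open>Once membership in \<open>C\<close> is known, membership in \<open>B\<close> and in the
  symmetric difference determine each other. The condition is then dropped by comparing with the
  constant map \<open>()\<close>.\<close>

lemma cond_ent_mem_le:
  assumes B: "B \<in> sets M" and C: "C \<in> sets M"
  shows "cond_ent M (\<lambda>\<omega>. \<omega> \<in> B) (\<lambda>\<omega>. \<omega> \<in> C) \<le> ent M (\<lambda>\<omega>. \<omega> \<in> sym_diff B C)"
proof -
  let ?D = "sym_diff B C"
  have D: "?D \<in> sets M" using B C by auto
  note s = simple_function_mem[OF B] simple_function_mem[OF C] simple_function_mem[OF D]
  have "cond_ent M (\<lambda>\<omega>. \<omega> \<in> B) (\<lambda>\<omega>. \<omega> \<in> C) \<le> cond_ent M (\<lambda>\<omega>. \<omega> \<in> ?D) (\<lambda>\<omega>. \<omega> \<in> C)"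
    by (rule cond_ent_le_of_determined[OF s(3,1,2)]) auto
  also have "\<dots> \<le> cond_ent M (\<lambda>\<omega>. \<omega> \<in> ?D) (\<lambda>_. ())"
    by (rule cond_ent_mono[OF s(3,2)]) auto
  also have "ent M (\<lambda>\<omega>. (\<omega> \<in> ?D, ())) = ent M (\<lambda>\<omega>. \<omega> \<in> ?D)"
    by (rule ent_cong) auto
  then have "cond_ent M (\<lambda>\<omega>. \<omega> \<in> ?D) (\<lambda>_. ()) \<le> ent M (\<lambda>\<omega>. \<omega> \<in> ?D)"
    using ent_nonneg[of "\<lambda>_. ()"] by (simp add: cond_ent_def)
  finally show ?thesis .
qed

text \<open>Continuity at 0 of the binary entropy function. The limit is one-sided, so events of
  probability 0 are treated apart.\<close>

lemma ent_small_event: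
  assumes "0 < e"
  shows "\<exists>d>0. \<forall>B\<in>sets M. prob B < d \<longrightarrow> ent M (\<lambda>\<omega>. \<omega> \<in> B) < e"
proof -
  have "((\<lambda>t::real. - (t * ln t) - ((1 - t) * ln (1 - t))) \<longlongrightarrow> 0) (at_right 0)"
    by real_asymp
  then have "eventually (\<lambda>t::real. - (t * ln t) - ((1 - t) * ln (1 - t)) < e) (at_right 0)"
    using assms by (rule order_tendstoD)
  then obtain d where d: "d > 0" "\<And>t. 0 < t \<Longrightarrow> t < d \<Longrightarrow> - (t * ln t) - ((1 - t) * ln (1 - t)) < e"
    unfolding eventually_at_right_field by auto
  show ?thesis
  proof (intro exI[of _ d] conjI ballI impI)
    fix B assume "B \<in> sets M" "prob B < d"
    then show "ent M (\<lambda>\<omega>. \<omega> \<in> B) < e"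
      using d(2)[of "prob B"] assms by (cases "prob B = 0") (auto simp: ent_mem zero_less_measure_iff)
  qed (use d in auto)
qed

end

section \<open>Invariant sets and ergodicity of powers\<close>

locale measure_preserving = prob_space M for M :: "'b measure" and T :: "'b \<Rightarrow> 'b" +
  assumes T_measurable [measurable]: "T \<in> M \<rightarrow>\<^sub>M M"
    and T_invariant: "invariant_measure M T"
begin

lemma Tn_measurable [measurable]: "(T ^^ n) \<in> M \<rightarrow>\<^sub>M M"
  by (rule measurable_compose_n[OF T_measurable])

lemma distr_T: "distr M M T = M"
  by (rule measure_eqI) (use T_invariant in \<open>auto simp: emeasure_distr invariant_measure_def\<close>)

lemma AE_T:
  assumes "AE x in M. P x" shows "AE x in M. P (T x)"
proof -
  have "AE x in distr M M T. P x" unfolding distr_T by fact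
  then show ?thesis by (rule AE_distrD[OF T_measurable])
qed

lemma AE_Tn:
  assumes "AE x in M. P x" shows "AE x in M. P ((T ^^ n) x)"
proof (induction n)
  case (Suc n)
  from AE_T[OF this] show ?case by (simp add: funpow_swap1)
qed (use assms in simp)

lemma invariant_measure_power: "invariant_measure M (T ^^ n)"
proof -
  have "distr M M (T ^^ n) = M"
  proof (induction n)
    case (Suc n)
    have "distr M M (T ^^ Suc n) = distr (distr M M T) M (T ^^ n)"
      by (subst distr_distr) (simp_all only: funpow_Suc_right T_measurable Tn_measurable)
    also have "\<dots> = M" by (simp only: distr_T Suc)
    finally show ?case .
  qed (simp add: distr_id2)
  then show ?thesis
    unfolding invariant_measure_def by (metis emeasure_distr Tn_measurable)
qed

lemma measure_preserving_power: "measure_preserving M (T ^^ n)"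
  by unfold_locales (simp_all add: invariant_measure_power)

lemma prob_vimage_Tn: "B \<in> sets M \<Longrightarrow> prob ((T ^^ n) -` B \<inter> space M) = prob B"
  using invariant_measure_power[of n] by (simp add: invariant_measure_def measure_def)

lemma invariant_sets_mod_iff:
  "B \<in> invariant_sets_mod M (T ^^ n) \<longleftrightarrow> B \<in> sets M \<and> (AE x in M. (T ^^ n) x \<in> B \<longleftrightarrow> x \<in> B)"
proof -
  have "emeasure M (sym_diff ((T ^^ n) -` B \<inter> space M) B) = 0 \<longleftrightarrow>
      (AE x in M. (T ^^ n) x \<in> B \<longleftrightarrow> x \<in> B)" if B: "B \<in> sets M"
  proof -
    have "sym_diff ((T ^^ n) -` B \<inter> space M) B \<in> sets M" using B by measurable
    moreover have "{x \<in> space M. \<not> ((T ^^ n) x \<in> B \<longleftrightarrow> x \<in> B)} = sym_diff ((T ^^ n) -` B \<inter> space M) B"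
      using sets.sets_into_space[OF B] by auto
    ultimately have "(AE x in M. (T ^^ n) x \<in> B \<longleftrightarrow> x \<in> B) \<longleftrightarrow>
        emeasure M (sym_diff ((T ^^ n) -` B \<inter> space M) B) = 0"
      by (rule AE_iff_measurable)
    then show ?thesis by blast
  qed
  then show ?thesis by (auto simp: invariant_sets_mod_def)
qed

lemma AE_invariant_mult:
  assumes "AE x in M. (T ^^ n) x \<in> B \<longleftrightarrow> x \<in> B"
  shows "AE x in M. (T ^^ (n * j)) x \<in> B \<longleftrightarrow> x \<in> B"
proof (induction j)
  case (Suc j)
  from AE_Tn[OF assms, of "n * j"] Suc show ?case
    by eventually_elim (simp add: funpow_add)
qed simp

lemma invariant_sets_mod_mult:
  "invariant_sets_mod M (T ^^ n) \<subseteq> invariant_sets_mod M (T ^^ (n * j))"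
  by (auto simp: invariant_sets_mod_iff AE_invariant_mult)

text \<open>Replace \<open>B\<close> by the strictly invariant set of points visiting \<open>B\<close> infinitely often.\<close>

lemma ergodic_invariant_mod:
  assumes erg: "ergodic M T" and B: "B \<in> sets M" and inv: "AE x in M. T x \<in> B \<longleftrightarrow> x \<in> B"
  shows "prob B = 0 \<or> prob B = 1"
proof -
  define C where "C = {x \<in> space M. \<exists>\<^sub>\<infinity>n. (T ^^ n) x \<in> B}"
  have [measurable]: "B \<in> sets M" by fact
  have C: "C \<in> sets M" unfolding C_def INFM_nat by measurable
  have "(\<exists>\<^sub>\<infinity>n. (T ^^ n) (T x) \<in> B) \<longleftrightarrow> (\<exists>\<^sub>\<infinity>n. (T ^^ n) x \<in> B)" for x
  proof -
    have "(\<exists>\<^sub>\<infinity>n. (T ^^ n) (T x) \<in> B) \<longleftrightarrow> (\<exists>\<^sub>\<infinity>n. (T ^^ Suc n) x \<in> B)"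
      by (simp add: funpow_Suc_right del: funpow.simps)
    also have "\<dots> \<longleftrightarrow> (\<exists>\<^sub>\<infinity>n. (T ^^ n) x \<in> B)"
      unfolding cofinite_eq_sequentially frequently_def
      using eventually_sequentially_Suc[of "\<lambda>n. (T ^^ n) x \<notin> B"] by (simp only:)
    finally show ?thesis .
  qed
  then have "T -` C \<inter> space M = C"
    using measurable_space[OF T_measurable] by (auto simp: C_def)
  then have "emeasure M C = 0 \<or> emeasure M C = 1" using erg C by (auto simp: ergodic_def)
  then have C01: "prob C = 0 \<or> prob C = 1" by (auto simp: measure_def)
  have "AE x in M. \<forall>n. (T ^^ n) x \<in> B \<longleftrightarrow> x \<in> B"
    unfolding AE_all_countable using AE_invariant_mult[of 1 B] inv by simp
  then have "AE x in M. x \<in> C \<longleftrightarrow> x \<in> B"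
    using AE_space by eventually_elim (auto simp: C_def)
  then have "prob C = prob B" by (rule finite_measure_eq_AE[OF _ C B])
  then show ?thesis using C01 by simp
qed

text \<open>Take an atom \<open>C\<close> of the algebra of \<open>T\<^sup>N\<close>-invariant sets, and the least \<open>q > 0\<close> for which
  \<open>C\<close> meets \<open>T\<^sup>-\<^sup>q C\<close> in positive measure. Then \<open>C\<close> is \<open>T\<^sup>q\<close>-invariant and \<open>q\<close> divides \<open>N\<close>; a prime
  \<open>l\<close> dividing \<open>q\<close> would make the union of the \<open>T\<^sup>-\<^sup>l\<^sup>i C\<close> a set which is \<open>T\<^sup>l\<close>-invariant, but not
  \<open>T\<close>-invariant.\<close>

lemma ergodic_power:
  assumes erg: "ergodic M T" and N: "N > 0"
    and primes: "\<And>l. prime l \<Longrightarrow> l dvd N \<Longrightarrow> invariant_sets_mod M (T ^^ l) \<subseteq> invariant_sets_mod M T"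
    and B: "B \<in> sets M" and B_inv: "AE x in M. (T ^^ N) x \<in> B \<longleftrightarrow> x \<in> B"
  shows "prob B = 0 \<or> prob B = 1"
proof (rule ccontr)
  assume neg: "\<not> (prob B = 0 \<or> prob B = 1)"
  define J where "J n = {C \<in> sets M. AE x in M. (T ^^ n) x \<in> C \<longleftrightarrow> x \<in> C}" for n
  have J1: "prob C = 0 \<or> prob C = 1" if "C \<in> J 1" for C
    using ergodic_invariant_mod[OF erg, of C] that by (simp add: J_def)
  have vim: "(T ^^ j) -` C \<inter> space M \<in> sets M" if "C \<in> J n" for j n C
    by (rule measurable_sets[OF Tn_measurable]) (use that in \<open>simp add: J_def\<close>)
  \<comment> \<open>If \<open>C\<close> is invariant under \<open>T ^^ (l * t)\<close>, then pulling
    back by \<open>T ^^ l\<close> permutes these t pieces cyclically up to null sets, so their union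
    is \<open>T ^^ l\<close>-invariant.\<close>
  define S where "S C l t = (\<Union>i<t. ((T ^^ (l * i)) -` C \<inter> space M))" for C and l t :: nat
  have S_sets: "S C l t \<in> sets M" if "C \<in> J n" for C l t n
    unfolding S_def by (intro sets.finite_UN vim[OF that]) auto
  have S_mem: "x \<in> S C l t \<longleftrightarrow> (\<exists>i<t. (T ^^ (l * i)) x \<in> C)" if "x \<in> space M" for x C l t
    using that by (auto simp: S_def)
  have S_J: "S C l t \<in> J l" if C: "C \<in> J (l * t)" and t: "t > 0" for C l t
  proof -
    have "AE x in M. (T ^^ (l * t)) x \<in> C \<longleftrightarrow> x \<in> C" using C by (simp add: J_def)
    then have "AE x in M. (T ^^ l) x \<in> S C l t \<longleftrightarrow> x \<in> S C l t"
      using AE_space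
    proof eventually_elim
      case (elim x)
      have Tx: "(T ^^ l) x \<in> space M" using elim(2) measurable_space[OF Tn_measurable] by blast
      have "(\<exists>i<t. (T ^^ (l * i)) ((T ^^ l) x) \<in> C) \<longleftrightarrow> (\<exists>i<t. (T ^^ (l * Suc i)) x \<in> C)"
        by (simp add: funpow_add[symmetric, THEN fun_cong, unfolded o_def] add.commute)
      also have "\<dots> \<longleftrightarrow> (\<exists>i<t. (T ^^ (l * i)) x \<in> C)"
      proof
        assume "\<exists>i<t. (T ^^ (l * Suc i)) x \<in> C"
        then obtain i where i: "i < t" "(T ^^ (l * Suc i)) x \<in> C" by blast
        show "\<exists>i<t. (T ^^ (l * i)) x \<in> C"
        proof (cases "Suc i = t")
          case True
          then have "x \<in> C" using i elim(1) by simp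
          then show ?thesis using t by (intro exI[of _ 0]) simp
        next
          case False
          then show ?thesis using i by (intro exI[of _ "Suc i"]) simp
        qed
      next
        assume "\<exists>i<t. (T ^^ (l * i)) x \<in> C"
        then obtain i where i: "i < t" "(T ^^ (l * i)) x \<in> C" by blast
        show "\<exists>i<t. (T ^^ (l * Suc i)) x \<in> C"
        proof (cases i)
          case 0
          then have "(T ^^ (l * t)) x \<in> C" using i elim(1) by simp
          then show ?thesis using t by (intro exI[of _ "t - 1"]) simp
        next
          case (Suc i')
          then show ?thesis using i by (intro exI[of _ i']) simp
        qed
      qed
      finally show ?case using S_mem[OF elim(2)] S_mem[OF Tx] by simp
    qed
    then show ?thesis using S_sets[OF C] by (simp add: J_def)
  qed
  \<comment> \<open>The pullbacks of \<open>C\<close> under the first N powers of \<open>T\<close>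
    form a \<open>T\<close>-invariant non-null set, so they cover almost everything; all of them
    have the measure of \<open>C\<close>.\<close>
  have lower: "1 / real N \<le> prob C" if C: "C \<in> J N" and pos: "prob C > 0" for C
  proof -
    have CN: "C \<in> J (1 * N)" using C by simp
    have "C \<subseteq> S C 1 N" using N C sets.sets_into_space[of C M] S_mem[of _ C 1 N]
      by (force simp: J_def)
    then have "prob C \<le> prob (S C 1 N)" by (rule finite_measure_mono[OF _ S_sets[OF C]])
    then have "prob (S C 1 N) = 1" using J1[OF S_J[OF CN N]] pos by auto
    moreover have "prob (S C 1 N) \<le> (\<Sum>i<N. prob ((T ^^ (1 * i)) -` C \<inter> space M))"
      unfolding S_def by (rule finite_measure_subadditive_finite) (use vim[OF C] in auto)
    moreover have "\<dots> = N * prob C"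
      using C by (simp add: prob_vimage_Tn J_def)
    ultimately show ?thesis using N by (simp add: field_simps)
  qed
  define V where "V = {prob C | C. C \<in> J N \<and> C \<subseteq> B \<and> prob C > 0}"
  have V_ne: "V \<noteq> {}" using B B_inv neg by (auto simp: V_def J_def zero_less_measure_iff)
  have V_bdd: "bdd_below V" by (auto simp: V_def intro: bdd_belowI[of _ 0])
  \<comment> \<open>Where the atom comes from: if \<open>C\<close> is within 1/N of the infimum,
    then an invariant non-null \<open>D\<close> inside \<open>C\<close> has measure at least
    \<open>Inf V\<close>, so \<open>C - D\<close> has measure below 1/N and is null by
    \<open>lower\<close>.\<close>
  have "Inf V < Inf V + 1 / N" using N by simp
  then obtain C where C: "C \<in> J N" "C \<subseteq> B" "prob C > 0" "prob C < Inf V + 1 / N"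
    using cInf_less_iff[OF V_ne V_bdd, of "Inf V + 1 / N"] by (auto simp: V_def)
  have Cs: "C \<in> sets M" using C by (simp add: J_def)
  have C_lt: "prob C < 1"
    using finite_measure_mono[OF C(2) B] neg prob_le_1[of B] by linarith
  have atom: "AE x in M. x \<in> C \<longrightarrow> x \<in> D" if D: "D \<in> J N" "D \<subseteq> C" "prob D > 0" for D
  proof -
    have Ds: "D \<in> sets M" using D by (simp add: J_def)
    have "AE x in M. (T ^^ N) x \<in> C \<longleftrightarrow> x \<in> C" "AE x in M. (T ^^ N) x \<in> D \<longleftrightarrow> x \<in> D"
      using C D by (auto simp: J_def)
    then have "AE x in M. (T ^^ N) x \<in> C - D \<longleftrightarrow> x \<in> C - D" by eventually_elim auto
    then have CD: "C - D \<in> J N" using Cs Ds by (auto simp: J_def)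
    have "prob D \<in> V" using D C by (auto simp: V_def)
    then have "Inf V \<le> prob D" by (rule cInf_lower[OF _ V_bdd])
    then have "prob (C - D) < 1 / N"
      using C(4) finite_measure_Diff[OF Cs Ds D(2)] by simp
    then have "prob (C - D) = 0" using lower[OF CD] zero_less_measure_iff[of M "C - D"] by auto
    then have "AE x in M. x \<notin> C - D" using Cs Ds
      by (metis AE_not_in emeasure_eq_measure ennreal_0 null_setsI sets.Diff)
    then show ?thesis by eventually_elim auto
  qed
  define q where "q = (LEAST j. 0 < j \<and> prob (C \<inter> ((T ^^ j) -` C \<inter> space M)) > 0)"
  have recur: "prob (C \<inter> ((T ^^ j) -` C \<inter> space M)) = prob C" if "C \<in> J j" for j
    by (rule finite_measure_eq_AE[OF _ sets.Int[OF Cs vim[OF that]] Cs])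
      (use that AE_space in \<open>auto simp: J_def elim!: AE_mp\<close>)
  have q: "0 < q" "prob (C \<inter> ((T ^^ q) -` C \<inter> space M)) > 0"
    using LeastI[of "\<lambda>j. 0 < j \<and> prob (C \<inter> ((T ^^ j) -` C \<inter> space M)) > 0" N] N recur[OF C(1)] C(3)
    unfolding q_def by auto
  have q_least: "prob (C \<inter> ((T ^^ j) -` C \<inter> space M)) = 0" if "0 < j" "j < q" for j
    using not_less_Least[of j "\<lambda>j. 0 < j \<and> prob (C \<inter> ((T ^^ j) -` C \<inter> space M)) > 0"] that
    unfolding q_def by (auto simp: zero_less_measure_iff)
  have Cq: "C \<in> J q"
  proof -
    have D: "C \<inter> ((T ^^ q) -` C \<inter> space M) \<in> J N"
    proof -
      have inv: "AE x in M. (T ^^ N) x \<in> C \<longleftrightarrow> x \<in> C" using C by (simp add: J_def)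
      have "AE x in M. (T ^^ N) x \<in> C \<inter> ((T ^^ q) -` C \<inter> space M) \<longleftrightarrow>
          x \<in> C \<inter> ((T ^^ q) -` C \<inter> space M)"
        using inv AE_Tn[OF inv, of q] AE_space
      proof eventually_elim
        case (elim x)
        have "(T ^^ q) ((T ^^ N) x) = (T ^^ N) ((T ^^ q) x)"
          by (simp add: funpow_add[symmetric, THEN fun_cong, unfolded o_def] add.commute)
        then show ?case using elim measurable_space[OF Tn_measurable, of x N] by auto
      qed
      then show ?thesis using sets.Int[OF Cs vim[OF C(1)]] by (simp add: J_def)
    qed
    \<comment> \<open>The atom is almost contained in its pullback under \<open>T ^^ q\<close>; both
      have the same measure, so they agree modulo null sets.\<close>
    have 1: "AE x in M. x \<in> C \<longrightarrow> x \<in> C \<inter> ((T ^^ q) -` C \<inter> space M)"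
      by (rule atom[OF D _ q(2)]) auto
    define Q where "Q = (T ^^ q) -` C \<inter> space M"
    have Q: "Q \<in> sets M" unfolding Q_def by (rule vim[OF C(1)])
    have "prob (C \<inter> Q) = prob C"
      by (rule finite_measure_eq_AE[OF _ sets.Int[OF Cs Q] Cs]) (use 1 in \<open>auto simp: Q_def\<close>)
    moreover have "prob Q = prob C" unfolding Q_def by (rule prob_vimage_Tn[OF Cs])
    ultimately have "prob (Q - C \<inter> Q) = 0"
      by (subst finite_measure_Diff[OF Q sets.Int[OF Cs Q]]) auto
    then have "AE x in M. x \<notin> Q - C \<inter> Q"
      using prob_eq_0[OF sets.Diff[OF Q sets.Int[OF Cs Q]]] by blast
    then have "AE x in M. x \<in> space M \<longrightarrow> (T ^^ q) x \<in> C \<longrightarrow> x \<in> C"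
      by eventually_elim (auto simp: Q_def)
    with 1 AE_space have "AE x in M. (T ^^ q) x \<in> C \<longleftrightarrow> x \<in> C" by eventually_elim auto
    then show ?thesis using Cs by (simp add: J_def)
  qed
  have "q dvd N"
  proof -
    \<comment> \<open>This form of Bezout uses only nonnegative powers of \<open>T\<close>. It makes
      \<open>C\<close> invariant under the power gcd q N, which by minimality of q cannot be smaller
      than q.\<close>
    obtain a b where ab: "q * a = N * b + gcd q N" using bezout_nat[of q N] q(1) by auto
    have "AE x in M. (T ^^ (q * a)) x \<in> C \<longleftrightarrow> x \<in> C"
      using Cq by (intro AE_invariant_mult) (simp add: J_def)
    moreover have "AE x in M. (T ^^ (N * b)) x \<in> C \<longleftrightarrow> x \<in> C"
      using C(1) by (intro AE_invariant_mult) (simp add: J_def)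
    note AE_Tn[OF this, of "gcd q N"]
    ultimately have "AE x in M. (T ^^ gcd q N) x \<in> C \<longleftrightarrow> x \<in> C"
      by eventually_elim (simp add: ab funpow_add)
    then have "C \<in> J (gcd q N)" using Cs by (simp add: J_def)
    from recur[OF this] have "\<not> gcd q N < q" using q_least[of "gcd q N"] q(1) C(3) by auto
    then show ?thesis using q(1) by (metis gcd_le1_nat gcd_nat.absorb_iff1 le_neq_implies_less neq0_conv)
  qed
  show False
  proof (cases "q = 1")
    case True
    then show False using J1[of C] Cq C(3) C_lt by auto
  next
    case False
    then obtain l where l: "prime l" "l dvd q" using prime_factor_nat by blast
    then obtain t where t: "q = l * t" by blast
    have t0: "t > 0" using t q(1) by auto
    have E: "S C l t \<in> J l" using S_J[of C l t] Cq t t0 by simp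
    then have "S C l t \<in> invariant_sets_mod M T"
      using primes[OF l(1) dvd_trans[OF l(2) \<open>q dvd N\<close>]] invariant_sets_mod_iff[of "S C l t" l]
      by (auto simp: J_def)
    then have "AE x in M. T x \<in> S C l t \<longleftrightarrow> x \<in> S C l t"
      using invariant_sets_mod_iff[of _ 1] by simp
    \<comment> \<open>Almost no point of \<open>C\<close> returns at a time l i + 1, as this lies
      strictly between 0 and q: l i + 1 < l (i + 1) \<le> q. Yet \<open>T\<close>-invariance of
      \<open>S C l t\<close> would force such a return for almost every point of
      \<open>C\<close>.\<close>
    moreover have "AE x in M. \<forall>i\<in>{..<t}. \<not> (x \<in> C \<and> (T ^^ (l * i + 1)) x \<in> C)"
    proof -
      have "AE x in M. \<not> (x \<in> C \<and> (T ^^ (l * i + 1)) x \<in> C)" if "i < t" for i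
      proof -
        have "l * i + 1 < l * Suc i" using prime_gt_1_nat[OF l(1)] by simp
        also have "\<dots> \<le> q" using that t by (simp del: mult_Suc_right)
        finally have "prob (C \<inter> ((T ^^ (l * i + 1)) -` C \<inter> space M)) = 0"
          by (intro q_least) auto
        then have "AE x in M. x \<notin> C \<inter> ((T ^^ (l * i + 1)) -` C \<inter> space M)"
          using sets.Int[OF Cs vim[OF C(1)]]
          by (metis AE_not_in emeasure_eq_measure ennreal_0 null_setsI)
        then show ?thesis using AE_space by eventually_elim auto
      qed
      then show ?thesis by (intro AE_finite_allI) auto
    qed
    ultimately have "AE x in M. x \<notin> C"
      using AE_space
    proof eventually_elim
      case (elim x)
      have Tx: "T x \<in> space M" using elim(3) measurable_space[OF T_measurable] by blast
      show ?case
      proof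
        assume x: "x \<in> C"
        then have "x \<in> S C l t" using S_mem[OF elim(3)] t0 by (auto intro: exI[of _ 0])
        then obtain i where "i < t" "(T ^^ (l * i)) (T x) \<in> C" using elim(1) S_mem[OF Tx] by auto
        then show False using elim(2) x by (simp add: funpow_swap1)
      qed
    qed
    then have "prob C = 0" using prob_eq_0[OF Cs] by simp
    then show False using C(3) by simp
  qed
qed

end

text \<open>The orbit of a Hahn set of \<open>M - N\<close> is again a Hahn set, and it is strictly invariant.\<close>

lemma invariant_measures_eq_or_singular:
  fixes M N :: "'b measure"
  assumes M: "measure_preserving M T" and N: "measure_preserving N T"
    and sets: "sets N = sets M" and space: "space M = UNIV"
    and S: "S \<in> M \<rightarrow>\<^sub>M M" and TS: "\<And>x. T (S x) = x" and ST: "\<And>x. S (T x) = x"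
    and ergM: "ergodic M T" and ergN: "ergodic N T"
  shows "M = N \<or> (\<exists>E\<in>sets M. emeasure M E = 1 \<and> emeasure N E = 0)"
proof -
  interpret M: measure_preserving M T by fact
  interpret N: measure_preserving N T by fact
  have spaceN: "space N = UNIV" using sets_eq_imp_space_eq[OF sets] space by simp
  have [measurable]: "S \<in> M \<rightarrow>\<^sub>M M" by fact
  have Sn [measurable]: "(S ^^ n) \<in> M \<rightarrow>\<^sub>M M" for n by (rule measurable_compose_n[OF S])
  have TSn: "(T ^^ n) ((S ^^ n) x) = x" and STn: "(S ^^ n) ((T ^^ n) x) = x" for n x
  proof (induction n)
    case (Suc n)
    { case 1 show ?case using Suc by (simp add: funpow_swap1[of T] TS) }
    { case 2 show ?case using Suc by (simp add: funpow_swap1[of S] ST) }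
  qed simp_all
  have TN: "emeasure M ((T ^^ n) -` X) = emeasure M X" "emeasure N ((T ^^ n) -` X) = emeasure N X"
    if "X \<in> sets M" for X n
    using M.invariant_measure_power[of n] N.invariant_measure_power[of n] that
    by (auto simp: invariant_measure_def space spaceN sets)
  have vS: "(S ^^ n) -` X \<in> sets M" and vT: "(T ^^ n) -` X \<in> sets M" if "X \<in> sets M" for X n
    using measurable_sets[OF Sn that, of n] measurable_sets[OF M.Tn_measurable that, of n]
    by (auto simp: space)
  have SN: "emeasure M ((S ^^ n) -` X) = emeasure M X" "emeasure N ((S ^^ n) -` X) = emeasure N X"
    if X: "X \<in> sets M" for X n
  proof -
    have "(T ^^ n) -` ((S ^^ n) -` X) = X" by (auto simp: STn)
    then show "emeasure M ((S ^^ n) -` X) = emeasure M X"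
      "emeasure N ((S ^^ n) -` X) = emeasure N X"
      using TN[OF vS[OF X], of n n] by auto
  qed
  from finite_unsigned_Hahn_decomposition[OF M.finite_measure_axioms N.finite_measure_axioms sets]
  obtain E where E: "E \<in> sets M" and Hahn: "\<forall>X\<in>sets M. X \<subseteq> E \<longrightarrow> emeasure N X \<le> emeasure M X"
    "\<forall>X\<in>sets M. X \<inter> E = {} \<longrightarrow> emeasure M X \<le> emeasure N X"
    by (elim bexE conjE)
  have pos: "emeasure N X \<le> emeasure M X" if "X \<in> sets M" "X \<subseteq> E" for X
    using Hahn(1) that by blast
  have neg: "emeasure M X \<le> emeasure N X" if "X \<in> sets M" "X \<inter> E = {}" for X
    using Hahn(2) that by blast
  \<comment> \<open>Even indices give the pullbacks under powers of \<open>T\<close>, odd ones those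
    under powers of its inverse, so that the two-sided orbit of \<open>E\<close> is a sequence to
    which \<open>disjointed\<close> applies.\<close>
  define A where "A k = (if even k then (T ^^ (k div 2)) -` E else (S ^^ (k div 2)) -` E)" for k :: nat
  define U where "U = (\<Union>k. A k)"
  have A: "A k \<in> sets M" for k using vS[OF E] vT[OF E] by (simp add: A_def)
  have U: "U \<in> sets M" using A by (auto simp: U_def)
  have U_alt: "x \<in> U \<longleftrightarrow> (\<exists>n. (T ^^ n) x \<in> E) \<or> (\<exists>n. (S ^^ n) x \<in> E)" for x
  proof
    assume "x \<in> U" then show "(\<exists>n. (T ^^ n) x \<in> E) \<or> (\<exists>n. (S ^^ n) x \<in> E)"
      by (auto simp: U_def A_def split: if_splits)
  next
    assume "(\<exists>n. (T ^^ n) x \<in> E) \<or> (\<exists>n. (S ^^ n) x \<in> E)"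
    then show "x \<in> U"
    proof (elim disjE exE)
      fix n assume "(T ^^ n) x \<in> E"
      then have "x \<in> A (2 * n)" by (simp add: A_def)
      then show "x \<in> U" by (auto simp: U_def)
    next
      fix n assume "(S ^^ n) x \<in> E"
      then have "x \<in> A (2 * n + 1)" by (simp add: A_def)
      then show "x \<in> U" by (auto simp: U_def)
    qed
  qed
  have "T x \<in> U \<longleftrightarrow> x \<in> U" for x
  proof -
    have 1: "(T ^^ n) (T x) \<in> E \<Longrightarrow> x \<in> U" for n
    proof -
      assume "(T ^^ n) (T x) \<in> E"
      then have "(T ^^ Suc n) x \<in> E" by (simp add: funpow_swap1)
      then show ?thesis unfolding U_alt by blast
    qed
    have 2: "(S ^^ n) (T x) \<in> E \<Longrightarrow> x \<in> U" for n
    proof (cases n)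
      case 0 assume "(S ^^ n) (T x) \<in> E"
      then have "(T ^^ 1) x \<in> E" using 0 by simp
      then show ?thesis unfolding U_alt by blast
    next
      case (Suc m) assume "(S ^^ n) (T x) \<in> E"
      then have "(S ^^ m) x \<in> E" using Suc by (simp add: funpow_swap1 ST)
      then show ?thesis unfolding U_alt by blast
    qed
    have 3: "(T ^^ n) x \<in> E \<Longrightarrow> T x \<in> U" for n
    proof (cases n)
      case 0 assume "(T ^^ n) x \<in> E"
      then have "(S ^^ 1) (T x) \<in> E" using 0 ST by simp
      then show ?thesis unfolding U_alt by blast
    next
      case (Suc m) assume "(T ^^ n) x \<in> E"
      then have "(T ^^ m) (T x) \<in> E" using Suc by (simp add: funpow_swap1)
      then show ?thesis unfolding U_alt by blast
    qed
    have 4: "(S ^^ n) x \<in> E \<Longrightarrow> T x \<in> U" for n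
    proof -
      assume "(S ^^ n) x \<in> E"
      then have "(S ^^ Suc n) (T x) \<in> E" by (simp add: funpow_Suc_right ST del: funpow.simps(2))
      then show ?thesis unfolding U_alt by blast
    qed
    show ?thesis using 1 2 3 4 U_alt[of x] U_alt[of "T x"] by blast
  qed
  then have TU: "T -` U \<inter> space M = U" "T -` U \<inter> space N = U" by (auto simp: space spaceN)
  have U01: "emeasure M U = 0 \<or> emeasure M U = 1" "emeasure N U = 0 \<or> emeasure N U = 1"
    using ergM ergN U TU by (auto simp: ergodic_def sets)
  \<comment> \<open>A power of \<open>T\<close> or \<open>S\<close> carries each piece of the orbit
    to \<open>E\<close> and preserves both measures, so the domination on \<open>E\<close> holds on
    every piece.\<close>
  have posA: "emeasure N X \<le> emeasure M X" if X: "X \<in> sets M" "X \<subseteq> A k" for X k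
  proof (cases "even k")
    case True
    have "(S ^^ (k div 2)) -` X \<subseteq> E" using X(2) True by (auto simp: A_def TSn)
    from pos[OF vS[OF X(1)] this] show ?thesis using SN[OF X(1)] by simp
  next
    case False
    have "(T ^^ (k div 2)) -` X \<subseteq> E" using X(2) False by (auto simp: A_def STn)
    from pos[OF vT[OF X(1)] this] show ?thesis using TN[OF X(1)] by simp
  qed
  have posU: "emeasure N X \<le> emeasure M X" if X: "X \<in> sets M" "X \<subseteq> U" for X
  proof -
    have d: "X \<inter> disjointed A k \<in> sets M" for k
      using X A sets.range_disjointed_sets[of A M] by auto
    have X_eq: "X = (\<Union>k. X \<inter> disjointed A k)"
      using X(2) UN_disjointed_eq[of A] by (auto simp: U_def)
    have dj: "disjoint_family (\<lambda>k. X \<inter> disjointed A k)"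
      using disjoint_family_disjointed[of A] by (auto simp: disjoint_family_on_def)
    have "emeasure N X = (\<Sum>k. emeasure N (X \<inter> disjointed A k))"
      by (subst X_eq, rule suminf_emeasure[symmetric]) (use d dj sets in auto)
    also have "\<dots> \<le> (\<Sum>k. emeasure M (X \<inter> disjointed A k))"
      by (intro suminf_le posA d) (use disjointed_subset[of A] in auto)
    also have "\<dots> = emeasure M X"
      by (subst (2) X_eq, rule suminf_emeasure) (use d dj in auto)
    finally show ?thesis .
  qed
  have negU: "emeasure M X \<le> emeasure N X" if X: "X \<in> sets M" "X \<inter> U = {}" for X
  proof (rule neg[OF X(1)])
    have "A 0 = E" by (simp add: A_def)
    then show "X \<inter> E = {}" using X(2) by (auto simp: U_def)
  qed
  have M1: "emeasure M UNIV = 1" and N1: "emeasure N UNIV = 1"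
    using M.emeasure_space_1 N.emeasure_space_1 by (simp_all add: space spaceN)
  \<comment> \<open>Two probability measures, one below the other, coincide: apply the bound to the
    complement as well.\<close>
  have eqI: "M = N" if le: "\<And>X. X \<in> sets M \<Longrightarrow> measure M X \<le> measure N X"
  proof (rule measure_eqI)
    fix X assume X: "X \<in> sets M"
    have "measure M (UNIV - X) \<le> measure N (UNIV - X)"
      using X by (intro le) (metis sets.compl_sets space)
    then have "measure M X = measure N X"
      using le[OF X] M.prob_compl[OF X] N.prob_compl[of X] X by (simp add: space spaceN sets)
    then show "emeasure M X = emeasure N X"
      by (simp add: M.emeasure_eq_measure N.emeasure_eq_measure)
  qed (simp add: sets)
  show ?thesis
  proof (cases "emeasure M U = 1")
    case True
    show ?thesis
    proof (cases "emeasure N U = 0")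
      case True
      then show ?thesis using U \<open>emeasure M U = 1\<close> by blast
    next
      case False
      then have NU: "emeasure N U = 1" using U01 by auto
      have "AE x in M. x \<in> U" "AE x in N. x \<in> U"
        using True NU U by (auto simp: sets M.AE_in_set_eq_1 N.AE_in_set_eq_1 measure_def)
      then have "measure N X \<le> measure M X" if X: "X \<in> sets M" for X
      proof -
        have "emeasure N X = emeasure N (X \<inter> U)"
          by (rule emeasure_eq_AE) (use \<open>AE x in N. x \<in> U\<close> X U sets in auto)
        also have "\<dots> \<le> emeasure M (X \<inter> U)" using X U by (intro posU) auto
        also have "\<dots> \<le> emeasure M X" using X by (intro emeasure_mono) auto
        finally show ?thesis by (simp add: M.emeasure_eq_measure N.emeasure_eq_measure)
      qed
      note le = this
      have "M = N"
      proof (rule eqI)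
        fix X assume X: "X \<in> sets M"
        have "measure N (UNIV - X) \<le> measure M (UNIV - X)"
          using X by (intro le) (metis sets.compl_sets space)
        then show "measure M X \<le> measure N X"
          using M.prob_compl[OF X] N.prob_compl[of X] X by (simp add: space spaceN sets)
      qed
      then show ?thesis ..
    qed
  next
    case False
    then have MU: "emeasure M U = 0" using U01 by auto
    \<comment> \<open>In this case \<open>M\<close> is carried by the complement of
      \<open>U\<close>, where \<open>N\<close> dominates it.\<close>
    have "M = N"
    proof (rule eqI)
      fix X assume X: "X \<in> sets M"
      have "emeasure M X = emeasure M (X - U)"
        using MU X U by (subst emeasure_Diff_null_set) auto
      also have "\<dots> \<le> emeasure N (X - U)" using X U by (intro negU) auto
      also have "\<dots> \<le> emeasure N X" using X U sets by (intro emeasure_mono) auto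
      finally show "measure M X \<le> measure N X" by (simp add: M.emeasure_eq_measure N.emeasure_eq_measure)
    qed
    then show ?thesis ..
  qed
qed

section \<open>Approximate determination of finite-valued maps, and itineraries as joins of
  partitions\<close>

context prob_space
begin

text \<open>Replace \<open>Q\<close> by the list of indicators of its fibres. Each fibre is close in
  measure to a set that some \<open>W N\<close> determines, hence has small conditional entropy; as
  the information in \<open>W N\<close> grows with N, the largest of finitely many N serves all
  fibres.\<close>

lemma cond_ent_small:
  fixes W :: "nat \<Rightarrow> 'a \<Rightarrow> 'c"
  assumes Q: "simple_function M Q" and W: "\<And>N. simple_function M (W N)"
    and W_mono: "\<And>N N' \<omega> \<omega>'. N \<le> N' \<Longrightarrow> W N' \<omega> = W N' \<omega>' \<Longrightarrow> W N \<omega> = W N \<omega>'"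
    and approx: "\<And>v d. v \<in> Q ` space M \<Longrightarrow> d > 0 \<Longrightarrow> \<exists>N. \<exists>C\<in>sets M.
       (\<forall>\<omega> \<omega>'. W N \<omega> = W N \<omega>' \<longrightarrow> (\<omega> \<in> C \<longleftrightarrow> \<omega>' \<in> C)) \<and>
       prob (sym_diff (Q -` {v} \<inter> space M) C) < d"
    and e: "e > 0"
  shows "\<exists>N. cond_ent M Q (W N) < e"
proof -
  have fin: "finite (Q ` space M)" using Q by (rule simple_functionD)
  then obtain vs where vs: "set vs = Q ` space M" by (meson finite_list)
  \<comment> \<open>One share for each entry of \<open>vs\<close>; the extra 1 makes the total
    strictly smaller than \<open>e\<close>, even for an empty list.\<close>
  define e' where "e' = e / (length vs + 1)"
  have "e' > 0" using e by (simp add: e'_def)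
  from ent_small_event[OF this] obtain d where d: "d > 0"
    "\<And>B. B \<in> sets M \<Longrightarrow> prob B < d \<Longrightarrow> ent M (\<lambda>\<omega>. \<omega> \<in> B) < e'" by blast
  have Qs: "Q -` {v} \<inter> space M \<in> sets M" for v by (rule simple_functionD(2)[OF Q])
  have "\<exists>N. cond_ent M (\<lambda>\<omega>. \<omega> \<in> Q -` {v} \<inter> space M) (W N) < e'" if v: "v \<in> Q ` space M" for v
  proof -
    obtain N C where C: "C \<in> sets M" "\<And>\<omega> \<omega>'. W N \<omega> = W N \<omega>' \<Longrightarrow> (\<omega> \<in> C \<longleftrightarrow> \<omega>' \<in> C)"
      "prob (sym_diff (Q -` {v} \<inter> space M) C) < d"
      using approx[OF v d(1)] by blast
    have "cond_ent M (\<lambda>\<omega>. \<omega> \<in> Q -` {v} \<inter> space M) (W N)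
        \<le> cond_ent M (\<lambda>\<omega>. \<omega> \<in> Q -` {v} \<inter> space M) (\<lambda>\<omega>. \<omega> \<in> C)"
      by (rule cond_ent_mono[OF simple_function_mem[OF Qs] W simple_function_mem[OF C(1)]])
        (use C(2) in blast)
    also have "\<dots> \<le> ent M (\<lambda>\<omega>. \<omega> \<in> sym_diff (Q -` {v} \<inter> space M) C)"
      by (rule cond_ent_mem_le[OF Qs C(1)])
    also have "\<dots> < e'" by (rule d(2)[OF _ C(3)]) (use Qs C(1) in blast)
    finally show ?thesis by blast
  qed
  then obtain n where n: "\<And>v. v \<in> Q ` space M \<Longrightarrow>
      cond_ent M (\<lambda>\<omega>. \<omega> \<in> Q -` {v} \<inter> space M) (W (n v)) < e'" by metis
  define N where "N = Max (insert 0 (n ` Q ` space M))"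
  have N: "n v \<le> N" if "v \<in> Q ` space M" for v
    unfolding N_def using fin that by (intro Max_ge) auto
  have le: "cond_ent M (\<lambda>\<omega>. \<omega> \<in> Q -` {v} \<inter> space M) (W N) \<le> e'" if v: "v \<in> Q ` space M" for v
  proof -
    have "cond_ent M (\<lambda>\<omega>. \<omega> \<in> Q -` {v} \<inter> space M) (W N) \<le>
        cond_ent M (\<lambda>\<omega>. \<omega> \<in> Q -` {v} \<inter> space M) (W (n v))"
      by (rule cond_ent_mono[OF simple_function_mem[OF Qs] W W]) (use W_mono[OF N[OF v]] in blast)
    then show ?thesis using n[OF v] by simp
  qed
  have sm: "simple_function M (\<lambda>\<omega>. map (\<lambda>v. \<omega> \<in> Q -` {v} \<inter> space M) vs)"
    by (intro simple_function_map simple_function_mem Qs)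
  have "cond_ent M Q (W N) \<le> cond_ent M (\<lambda>\<omega>. map (\<lambda>v. \<omega> \<in> Q -` {v} \<inter> space M) vs) (W N)"
  proof (rule cond_ent_le_of_determined[OF sm Q W])
    fix \<omega> \<omega>' assume w: "\<omega> \<in> space M" "\<omega>' \<in> space M"
      and "map (\<lambda>v. \<omega> \<in> Q -` {v} \<inter> space M) vs = map (\<lambda>v. \<omega>' \<in> Q -` {v} \<inter> space M) vs"
    then have "\<forall>v\<in>Q ` space M. \<omega> \<in> Q -` {v} \<inter> space M \<longleftrightarrow> \<omega>' \<in> Q -` {v} \<inter> space M"
      using vs by simp
    then show "Q \<omega> = Q \<omega>'" using w by auto
  qed
  also have "\<dots> \<le> (\<Sum>v\<leftarrow>vs. cond_ent M (\<lambda>\<omega>. \<omega> \<in> Q -` {v} \<inter> space M) (W N))"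
    by (rule cond_ent_map_le[OF simple_function_mem[OF Qs] W])
  also have "\<dots> \<le> (\<Sum>v\<leftarrow>vs. e')"
    by (rule sum_list_mono) (use le vs in auto)
  also have "\<dots> = length vs * e'" by (simp add: sum_list_triv)
  also have "\<dots> < e" using e by (simp add: e'_def field_simps)
  finally show ?thesis by blast
qed

lemma partition_entropy_fibres:
  "partition_entropy M ((\<lambda>v. X -` {v} \<inter> space M) ` (X ` space M)) = ent M X"
proof -
  have "inj_on (\<lambda>v. X -` {v} \<inter> space M) (X ` space M)" by (auto simp: inj_on_def)
  then show ?thesis by (simp add: partition_entropy_def ent_def sum.reindex sum_negf)
qed

definition cell :: "'a set set \<Rightarrow> 'a \<Rightarrow> 'a set" where
  "cell P x = (THE A. A \<in> P \<and> x \<in> A)"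

lemma cell_eq:
  assumes "finite_partition M P" "A \<in> P" "x \<in> A" shows "cell P x = A"
  unfolding cell_def
proof (rule the_equality)
  fix B assume "B \<in> P \<and> x \<in> B"
  moreover have "disjoint P" using assms(1) by (simp add: finite_partition_def partition_on_def)
  ultimately show "B = A" using assms(2,3) by (meson disjointD disjoint_iff)
qed (use assms in auto)

lemma cell_mem:
  assumes "finite_partition M P" "x \<in> space M" shows "cell P x \<in> P" "x \<in> cell P x"
proof -
  obtain A where "A \<in> P" "x \<in> A"
    using assms by (auto simp: finite_partition_def partition_on_def)
  then show "cell P x \<in> P" "x \<in> cell P x" using cell_eq[OF assms(1)] by auto
qed

lemma simple_function_cell:
  assumes P: "finite_partition M P" shows "simple_function M (cell P)"
  unfolding simple_function_def
proof (intro conjI ballI)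
  show "finite (cell P ` space M)"
    by (rule finite_subset[of _ P]) (use P cell_mem[OF P] in \<open>auto simp: finite_partition_def\<close>)
  fix A assume "A \<in> cell P ` space M"
  then have A: "A \<in> P" using cell_mem[OF P] by auto
  then have "cell P -` {A} \<inter> space M = A"
    using cell_mem[OF P] cell_eq[OF P A] P
    by (auto simp: finite_partition_def partition_on_def)
  then show "cell P -` {A} \<inter> space M \<in> sets M" using A P by (auto simp: finite_partition_def)
qed

text \<open>Two points lie in the same cell of the join iff they have the same itinerary through
  \<open>P\<close> for n steps. This carries bounds on \<open>ent\<close> over to the entropy of the
  definitions.\<close>

lemma iterated_partition_eq:
  assumes P: "finite_partition M P" and T: "\<And>x. x \<in> space M \<Longrightarrow> T x \<in> space M" and n: "n > 0"
  defines "X \<equiv> \<lambda>x. map (\<lambda>i. cell P ((T ^^ i) x)) [0..<n]"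
  shows "iterated_partition M T P n = (\<lambda>v. X -` {v} \<inter> space M) ` (X ` space M)"
proof -
  let ?R = "\<lambda>i. preimage_partition M (T ^^ i) P"
  have Tn: "(T ^^ i) x \<in> space M" if "x \<in> space M" for x i
    using that T by (induction i) auto
  have fibre: "X -` {X x} \<inter> space M = (\<Inter>i<n. (T ^^ i) -` cell P ((T ^^ i) x) \<inter> space M)"
    if x: "x \<in> space M" for x
  proof -
    have "cell P ((T ^^ i) y) = cell P ((T ^^ i) x) \<longleftrightarrow> (T ^^ i) y \<in> cell P ((T ^^ i) x)"
      if "y \<in> space M" for y i
      using cell_mem[OF P Tn[OF that, of i]] cell_mem[OF P Tn[OF x, of i]] cell_eq[OF P] by metis
    then show ?thesis using n by (auto simp: X_def)
  qed
  have mem_R: "B \<in> ?R i \<and> x \<in> B \<longleftrightarrow> B = (T ^^ i) -` cell P ((T ^^ i) x) \<inter> space M"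
    if x: "x \<in> space M" for x B i
  proof
    assume "B \<in> ?R i \<and> x \<in> B"
    then obtain A where A: "A \<in> P" "B = (T ^^ i) -` A \<inter> space M" "(T ^^ i) x \<in> A"
      by (auto simp: preimage_partition_def)
    then show "B = (T ^^ i) -` cell P ((T ^^ i) x) \<inter> space M" using cell_eq[OF P A(1,3)] by simp
  next
    assume B: "B = (T ^^ i) -` cell P ((T ^^ i) x) \<inter> space M"
    then have "x \<in> B" using cell_mem[OF P Tn[OF x]] x by auto
    then show "B \<in> ?R i \<and> x \<in> B"
      using cell_mem[OF P Tn[OF x]] B by (auto simp: preimage_partition_def)
  qed
  show ?thesis
  proof (intro equalityI subsetI)
    fix A assume "A \<in> iterated_partition M T P n"
    then obtain f where f: "\<And>i. i < n \<Longrightarrow> f (?R i) \<in> ?R i" "A = \<Inter> (f ` ?R ` {..<n})" "A \<noteq> {}"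
      by (auto simp: iterated_partition_def common_refinement)
    then obtain x where x: "x \<in> A" by blast
    have xs: "x \<in> space M"
    proof -
      have "x \<in> f (?R 0)" using x n unfolding f(2) by blast
      then show ?thesis using f(1)[OF n] by (auto simp: preimage_partition_def)
    qed
    have "f (?R i) = (T ^^ i) -` cell P ((T ^^ i) x) \<inter> space M" if "i < n" for i
      using mem_R[OF xs, of "f (?R i)" i] f(1)[OF that] x that by (auto simp: f(2))
    then have "A = X -` {X x} \<inter> space M" unfolding fibre[OF xs] f(2) by auto
    then show "A \<in> (\<lambda>v. X -` {v} \<inter> space M) ` (X ` space M)" using xs by blast
  next
    fix A assume "A \<in> (\<lambda>v. X -` {v} \<inter> space M) ` (X ` space M)"
    then obtain x where x: "x \<in> space M" "A = X -` {X x} \<inter> space M" by blast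
    \<comment> \<open>The cell is chosen from the partition \<open>R\<close> and not from an index,
      as \<open>common_refinement\<close> takes a set of partitions and several indices may give the
      same one.\<close>
    define f where "f R = (SOME B. B \<in> R \<and> x \<in> B)" for R
    have fR: "f (?R i) = (T ^^ i) -` cell P ((T ^^ i) x) \<inter> space M" for i
      unfolding f_def mem_R[OF x(1)] by simp
    have "f (?R i) \<in> ?R i" for i using mem_R[OF x(1), of "f (?R i)" i] fR by simp
    then have "f \<in> (\<Pi> R\<in>?R ` {..<n}. R)" by auto
    moreover have "A = \<Inter> (f ` ?R ` {..<n})" unfolding x(2) fibre[OF x(1)] by (auto simp: fR)
    moreover have "A \<noteq> {}" using x by auto
    ultimately show "A \<in> iterated_partition M T P n"
      unfolding iterated_partition_def common_refinement by blast
  qed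
qed

end

section \<open>Invariance of entropy under composition with a measure-preserving map\<close>

lemma (in measure_preserving) ent_compose:
  assumes X: "simple_function M X"
  shows "ent M (\<lambda>\<omega>. X ((T ^^ n) \<omega>)) = ent M X"
proof -
  have Tn: "\<omega> \<in> space M \<Longrightarrow> (T ^^ n) \<omega> \<in> space M" for \<omega>
    using measurable_space[OF Tn_measurable] by blast
  have "prob ((\<lambda>\<omega>. X ((T ^^ n) \<omega>)) -` {v} \<inter> space M) = prob (X -` {v} \<inter> space M)" for v
  proof -
    have "(\<lambda>\<omega>. X ((T ^^ n) \<omega>)) -` {v} \<inter> space M = (T ^^ n) -` (X -` {v} \<inter> space M) \<inter> space M"
      using Tn by auto
    then show ?thesis using prob_vimage_Tn[OF simple_functionD(2)[OF X]] by simp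
  qed
  then show ?thesis
    using simple_functionD(1)[OF X] Tn by (simp add: ent_superset[of "X ` space M"] image_subset_iff)
qed

lemma (in measure_preserving) simple_function_compose_Tn:
  assumes X: "simple_function M X" shows "simple_function M (\<lambda>\<omega>. X ((T ^^ n) \<omega>))"
proof -
  have Tn: "\<omega> \<in> space M \<Longrightarrow> (T ^^ n) \<omega> \<in> space M" for \<omega>
    using measurable_space[OF Tn_measurable] by blast
  show ?thesis unfolding simple_function_def
  proof (intro conjI ballI)
    show "finite ((\<lambda>\<omega>. X ((T ^^ n) \<omega>)) ` space M)"
      by (rule finite_subset[OF _ simple_functionD(1)[OF X]]) (use Tn in auto)
    fix v
    have "(\<lambda>\<omega>. X ((T ^^ n) \<omega>)) -` {v} \<inter> space M = (T ^^ n) -` (X -` {v} \<inter> space M) \<inter> space M"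
      using Tn by auto
    then show "(\<lambda>\<omega>. X ((T ^^ n) \<omega>)) -` {v} \<inter> space M \<in> sets M"
      using measurable_sets[OF Tn_measurable simple_functionD(2)[OF X]] by simp
  qed
qed

lemma (in measure_preserving) cond_ent_compose:
  assumes X: "simple_function M X" and Y: "simple_function M Y"
  shows "cond_ent M (\<lambda>\<omega>. X ((T ^^ n) \<omega>)) (\<lambda>\<omega>. Y ((T ^^ n) \<omega>)) = cond_ent M X Y"
  using ent_compose[OF simple_function_Pair[OF X Y], of n] ent_compose[OF Y, of n]
  by (simp add: cond_ent_def)

section \<open>Configurations\<close>

text \<open>Unions of cylinders over the window \<open>I\<close>; for finite \<open>I\<close> they
  are clopen, hence suited both to approximation and to limit arguments.\<close>

definition local_on :: "int set \<Rightarrow> 'a config set \<Rightarrow> bool" where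
  "local_on I A \<longleftrightarrow> (\<forall>x y. (\<forall>i\<in>I. x i = y i) \<longrightarrow> (x \<in> A \<longleftrightarrow> y \<in> A))"

lemma finite_UNIV_discrete: "finite (UNIV :: 'a::finite discrete set)"
  by (rule inj_on_finite[of of_discrete _ UNIV]) (auto simp: inj_on_def of_discrete_inject)

lemma open_coordinate: "open {x :: 'a config. P (x i)}"
proof -
  have "{x :: 'a config. P (x i)} = (\<lambda>x. x i) -` {c. P c}" by auto
  then show ?thesis using open_vimage[OF open_discrete continuous_on_product_coordinates] by metis
qed

lemma local_on_Compl: "local_on I A \<Longrightarrow> local_on I (- A)"
  by (simp add: local_on_def)

lemma open_local_on:
  assumes "finite I" "local_on I A" shows "open A"
proof -
  have "open (\<Inter>i\<in>I. {y :: 'a config. y i = x i})" for x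
    using assms(1) by (intro open_INT ballI open_coordinate) auto
  moreover have "A = (\<Union>x\<in>A. \<Inter>i\<in>I. {y. y i = x i})"
    using assms(2) unfolding local_on_def by auto
  ultimately show ?thesis by (metis (no_types, lifting) open_UN)
qed

lemma closed_local_on: "finite I \<Longrightarrow> local_on I A \<Longrightarrow> closed A"
  unfolding closed_def by (intro open_local_on local_on_Compl)

lemma open_config_contains_cylinder:
  fixes U :: "'a config set"
  assumes "open U" "x \<in> U"
  shows "\<exists>N::nat. \<forall>y. (\<forall>i\<in>{- int N..int N}. x i = y i) \<longrightarrow> y \<in> U"
proof -
  have "openin (product_topology (\<lambda>i. euclidean) UNIV) U"
    using assms(1) by (simp add: open_fun_def)
  from product_topology_open_contains_basis[OF this assms(2)]
  obtain X where X: "x \<in> (\<Pi>\<^sub>E i\<in>UNIV. X i)" "finite {i. X i \<noteq> UNIV}" "(\<Pi>\<^sub>E i\<in>UNIV. X i) \<subseteq> U"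
    by auto
  define N where "N = nat (Max (insert 0 (abs ` {i. X i \<noteq> UNIV})))"
  have N: "i \<in> {- int N..int N}" if "X i \<noteq> UNIV" for i
  proof -
    have "\<bar>i\<bar> \<le> Max (insert 0 (abs ` {i. X i \<noteq> UNIV}))" using X(2) that by (intro Max_ge) auto
    then show ?thesis by (auto simp: N_def)
  qed
  show ?thesis
  proof (intro exI[of _ N] allI impI)
    fix y assume y: "\<forall>i\<in>{- int N..int N}. x i = y i"
    have "y i \<in> X i" for i
    proof (cases "X i = UNIV")
      case False
      then show ?thesis using N[OF False] X(1) y by (metis PiE_mem UNIV_I)
    qed simp
    then show "y \<in> U" using X(3) by (auto simp: PiE_iff)
  qed
qed

lemma open_eq_UN_local:
  fixes U :: "'a config set"
  assumes "open U"
  obtains V where "\<And>N. local_on {- int N..int N} (V N)" "incseq V" "U = (\<Union>N. V N)"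
proof
  define V where "V N = {x. \<forall>y. (\<forall>i\<in>{- int N..int N}. x i = y i) \<longrightarrow> y \<in> U}" for N
  show "local_on {- int N..int N} (V N)" for N by (auto simp: local_on_def V_def)
  show "incseq V" by (fastforce simp: incseq_def V_def)
  show "U = (\<Union>N. V N)"
    using open_config_contains_cylinder[OF assms] by (auto simp: V_def)
qed

section \<open>Approximation of Borel sets by local sets, and compactness\<close>

lemma sets_local_on:
  assumes "sets M = sets borel" "finite I" "local_on I A" shows "A \<in> sets M"
  using open_local_on[OF assms(2,3)] assms(1) by auto

text \<open>Outer regularity gives an open \<open>U\<close> slightly larger than \<open>B\<close>,
  and \<open>U\<close> is an increasing union of local sets. Each of the two steps costs e /
  2.\<close>

lemma borel_approx_local:
  fixes M :: "'a::countable config measure"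
  assumes M: "prob_space M" and s: "sets M = sets borel" and B: "B \<in> sets M" and e: "e > 0"
  shows "\<exists>N C. local_on {- int N..int N} C \<and> measure M (sym_diff B C) < e"
proof -
  interpret prob_space M by fact
  have "emeasure M B = (INF U\<in>{U. B \<subseteq> U \<and> open U}. emeasure M U)"
    using outer_regular[OF s _ B[unfolded s]] by simp
  moreover have "emeasure M B < emeasure M B + ennreal (e / 2)"
    using e by (simp add: emeasure_eq_measure ennreal_less_iff flip: ennreal_plus)
  ultimately obtain U where U: "B \<subseteq> U" "open U" "emeasure M U < emeasure M B + ennreal (e / 2)"
    by (auto simp: INF_less_iff)
  have Us: "U \<in> sets M" using U(2) s by auto
  have "measure M U < measure M B + e / 2"
    using U(3) e by (simp add: emeasure_eq_measure ennreal_less_iff flip: ennreal_plus)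
  then have UB: "measure M (U - B) < e / 2"
    using finite_measure_Diff[OF Us B U(1)] by simp
  obtain V where V: "\<And>N. local_on {- int N..int N} (V N)" "incseq V" "U = (\<Union>N. V N)"
    using open_eq_UN_local[OF U(2)] by blast
  have Vs: "V N \<in> sets M" for N by (rule sets_local_on[OF s _ V(1)]) simp
  have "(\<lambda>N. measure M (V N)) \<longlonglongrightarrow> measure M U"
    unfolding V(3) by (rule finite_Lim_measure_incseq[OF _ V(2)]) (use Vs in auto)
  then have "eventually (\<lambda>N. measure M (V N) > measure M U - e / 2) sequentially"
    using e by (intro order_tendstoD) auto
  then obtain N where N: "measure M (V N) > measure M U - e / 2"
    by (auto simp: eventually_sequentially)
  have "measure M (sym_diff B (V N)) \<le> measure M ((U - B) \<union> (U - V N))"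
    by (rule finite_measure_mono) (use U V Us Vs B in auto)
  also have "\<dots> \<le> measure M (U - B) + measure M (U - V N)"
    by (rule measure_Un_le) (use Us Vs B in auto)
  also have "measure M (U - V N) < e / 2"
    using N V(3) by (subst finite_measure_Diff[OF Us Vs]) auto
  finally show ?thesis using UB V(1) by (intro exI[of _ N] exI[of _ "V N"]) auto
qed

text \<open>Agreement passes to open sets by increasing unions, and these form a generator of the
  Borel sets that is stable under intersections.\<close>

lemma measure_eqI_local:
  fixes M N :: "'a::countable config measure"
  assumes M: "prob_space M" "sets M = sets borel" and N: "prob_space N" "sets N = sets borel"
    and eq: "\<And>n C. local_on {- int n..int n} C \<Longrightarrow> measure M C = measure N C"
  shows "M = N"
proof -
  interpret M: prob_space M by fact
  interpret N: prob_space N by fact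
  have "measure M U = measure N U" if "open U" for U
  proof -
    obtain V where V: "\<And>N. local_on {- int N..int N} (V N)" "incseq V" "U = (\<Union>N. V N)"
      using open_eq_UN_local[OF \<open>open U\<close>] by blast
    have Vs: "range V \<subseteq> sets M" "range V \<subseteq> sets N"
      using sets_local_on[OF M(2) _ V(1)] sets_local_on[OF N(2) _ V(1)] by auto
    have "(\<lambda>n. measure M (V n)) \<longlonglongrightarrow> measure M U" "(\<lambda>n. measure N (V n)) \<longlonglongrightarrow> measure N U"
      unfolding V(3) using Vs V(2)
      by (auto intro: M.finite_Lim_measure_incseq N.finite_Lim_measure_incseq)
    then show ?thesis using eq[OF V(1)] LIMSEQ_unique by simp
  qed
  then have op: "emeasure M U = emeasure N U" if "open U" for U
    using that by (simp add: M.emeasure_eq_measure N.emeasure_eq_measure)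
  show ?thesis
  proof (rule measure_eqI_generator_eq[where E = "{U. open U}" and \<Omega> = UNIV and A = "\<lambda>_. UNIV"])
    show "Int_stable {U :: 'a config set. open U}" by (auto simp: Int_stable_def)
    show "sets M = sigma_sets UNIV {U. open U}" "sets N = sigma_sets UNIV {U. open U}"
      using M N by (simp_all add: borel_def)
  qed (simp_all add: op)
qed

lemma compact_UNIV_config: "compact (UNIV :: 'a::finite config set)"
proof -
  have "compact (UNIV :: 'a discrete set)"
    by (rule finite_imp_compact[OF finite_UNIV_discrete])
  then have "compact_space (product_topology (\<lambda>i::int. euclidean :: 'a discrete topology) UNIV)"
    unfolding compact_space_product_topology by (simp add: compact_space_def)
  then show ?thesis by (simp add: euclidean_product_topology compact_space_def)
qed

lemma decseq_closed_Inter_nonempty: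
  fixes C :: "nat \<Rightarrow> 'a::finite config set"
  assumes cl: "\<And>n. closed (C n)" and ne: "\<And>n. C n \<noteq> {}" and dec: "decseq C"
  shows "(\<Inter>n. C n) \<noteq> {}"
proof -
  have "UNIV \<inter> \<Inter> (range C) \<noteq> {}"
  proof (rule compact_imp_fip[OF compact_UNIV_config])
    fix F' assume F': "finite F'" "F' \<subseteq> range C"
    then obtain J where J: "finite J" "F' = C ` J" by (meson finite_subset_image)
    have "C (Max (insert 0 J)) \<subseteq> C j" if "j \<in> J" for j
      by (rule decseqD[OF dec Max_ge]) (use J(1) that in auto)
    then show "UNIV \<inter> \<Inter> F' \<noteq> {}" using ne[of "Max (insert 0 J)"] J(2) by blast
  next
    fix T assume "T \<in> range C" then show "closed T" using cl by blast
  qed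
  then show ?thesis by simp
qed

text \<open>By second countability the union of all open null sets is a countable union of such
  sets, hence null; it contains the complement of \<open>S\<close>.\<close>

lemma measure_support_subset_closed:
  fixes M :: "'b::second_countable_topology measure"
  assumes M: "borel_probability M" and S: "closed S" "measure_support M \<subseteq> S"
  shows "emeasure M S = 1"
proof -
  interpret prob_space M using M by (simp add: borel_probability_def)
  have s: "sets M = sets borel" using M by (simp add: borel_probability_def)
  define \<U> where "\<U> = {U. open U \<and> emeasure M U = 0}"
  obtain \<V> where V: "\<V> \<subseteq> \<U>" "countable \<V>" "\<Union>\<V> = \<Union>\<U>"
    using Lindelof[of \<U>] by (auto simp: \<U>_def)
  have "\<Union>\<V> \<in> null_sets M"
  proof -
    have "(\<Union>U\<in>\<V>. U) \<in> null_sets M"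
      by (rule null_sets_UN'[OF V(2)]) (use V(1) in \<open>auto simp: \<U>_def null_sets_def s\<close>)
    then show ?thesis by simp
  qed
  moreover have "- S \<subseteq> \<Union>\<V>"
  proof
    fix t assume "t \<in> - S"
    then have "t \<notin> measure_support M" using S(2) by blast
    then obtain U where "open U" "t \<in> U" "\<not> emeasure M U > 0"
      unfolding measure_support_def by blast
    then have "U \<in> \<U>" by (simp add: \<U>_def)
    then show "t \<in> \<Union>\<V>" using V(3) \<open>t \<in> U\<close> by blast
  qed
  moreover have "- S \<in> sets M" using S s by auto
  ultimately have "- S \<in> null_sets M" by (metis null_sets_subset)
  then have "emeasure M (space M - - S) = emeasure M (space M)"
    by (intro emeasure_Diff_null_set) auto
  moreover have "space M = UNIV" using sets_eq_imp_space_eq[OF s] by simp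
  ultimately show ?thesis using emeasure_space_1 by (simp add: Compl_eq_Diff_UNIV double_diff)
qed

section \<open>Bipermutative rules\<close>

lemma card_UNIV_discrete: "card (UNIV :: 'a discrete set) = CARD('a)"
proof (rule bij_betw_same_card[of of_discrete])
  show "bij_betw of_discrete (UNIV :: 'a discrete set) UNIV"
    by (rule bij_betwI[of _ _ _ discrete]) (auto simp: of_discrete_inverse discrete_inverse)
qed

text \<open>Permutativity is phrased through updates of a configuration at either end of the window
  of \<open>m\<close>, which removes the list encoding and the local rule from all later
  arguments.\<close>

locale bipermutative_rule =
  fixes F :: "'a::finite config \<Rightarrow> 'a config" and r s :: int
  assumes r_less_s: "r < s"
    and F_local: "(\<And>i. m + r \<le> i \<Longrightarrow> i \<le> m + s \<Longrightarrow> x i = y i) \<Longrightarrow> F x m = F y m"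
    and F_left: "\<exists>!a. F (x(m + r := a)) m = b"
    and F_right: "\<exists>!a. F (x(m + s := a)) m = b"

text \<open>Left and right permutativity each come with their own window and rule; minimality makes
  the windows coincide, and nontriviality makes them longer than one cell.\<close>

lemma bipermutative_rule_exists:
  assumes "bipermutative F" "\<not> trivial_CA F"
  shows "\<exists>r s. bipermutative_rule F r s"
proof -
  obtain r s f where lp: "smallest_neighborhood F r s" "local_rule F r s f"
    "\<And>u b. length u = nat (s - r) \<Longrightarrow> \<exists>!a. f (a # u) = b"
    using assms(1) by (auto simp: bipermutative_def left_permutative_def)
  obtain r' s' f' where rp: "smallest_neighborhood F r' s'" "local_rule F r' s' f'"
    "\<And>u b. length u = nat (s' - r') \<Longrightarrow> \<exists>!a. f' (u @ [a]) = b"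
    using assms(1) by (auto simp: bipermutative_def right_permutative_def)
  have le: "r \<le> s" "r' \<le> s'" using lp(2) rp(2) by (auto simp: local_rule_def)
  have "{r..s} = {r'..s'}"
    using lp(1) rp(1) unfolding smallest_neighborhood_def by blast
  then have eq: "r' = r" "s' = s" using le by auto
  have "r \<noteq> s" using assms(2) lp(1) by (auto simp: trivial_CA_def)
  with le have rs: "r < s" by simp
  have f: "F x m = f (map (\<lambda>u. x (m + u)) [r..s])" for x m
    using lp(2) by (auto simp: local_rule_def)
  have f': "F x m = f' (map (\<lambda>u. x (m + u)) [r..s])" for x m
    using rp(2) eq by (auto simp: local_rule_def)
  have "bipermutative_rule F r s"
  proof
    fix x y :: "'a config" and m assume "\<And>i. m + r \<le> i \<Longrightarrow> i \<le> m + s \<Longrightarrow> x i = y i"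
    then have "map (\<lambda>u. x (m + u)) [r..s] = map (\<lambda>u. y (m + u)) [r..s]" by simp
    then show "F x m = F y m" unfolding f by (rule arg_cong)
  next
    fix x :: "'a config" and m b
    have "F (x(m + r := a)) m = f (a # map (\<lambda>u. x (m + u)) [r+1..s])" for a
      using rs by (auto simp: f upto.simps[of r s] intro!: arg_cong[where f = f])
    then show "\<exists>!a. F (x(m + r := a)) m = b"
      using lp(3)[of "map (\<lambda>u. x (m + u)) [r+1..s]" b] by simp
    have "F (x(m + s := a)) m = f' (map (\<lambda>u. x (m + u)) [r..s-1] @ [a])" for a
      using rs by (auto simp: f' upto_rec2[of r s] intro!: arg_cong[where f = f'])
    then show "\<exists>!a. F (x(m + s := a)) m = b"
      using rp(3)[of "map (\<lambda>u. x (m + u)) [r..s-1]" b] eq by simp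
  qed (rule rs)
  then show ?thesis by blast
qed

context bipermutative_rule
begin

text \<open>Right permutativity lets \<open>x (m + s)\<close> be solved from \<open>F x m\<close>
  and the s - r coordinates before it, so a known block of that length propagates to the
  right.\<close>

lemma determined_right:
  assumes win: "\<And>i. j \<le> i \<Longrightarrow> i < j + (s - r) \<Longrightarrow> x i = y i"
    and F: "\<And>m. a \<le> m \<Longrightarrow> m < b \<Longrightarrow> F x m = F y m"
    and j: "a + r \<le> j" and i: "j \<le> i" "i < b + s"
  shows "x i = y i"
proof -
  have "j + int n < b + s \<longrightarrow> x (j + int n) = y (j + int n)" for n
  proof (induction n rule: less_induct)
    case (less n)
    show ?case
    proof (cases "int n < s - r")
      case True
      then show ?thesis using win by simp
    next
      case False
      show ?thesis
      proof
        assume lt: "j + int n < b + s"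
        \<comment> \<open>The cell whose window ends at j + n. The rest of the window agrees by
          induction, so writing the value of \<open>x\<close> at the last place of \<open>y\<close>
          reproduces \<open>F x m\<close>, and uniqueness applies.\<close>
        define m where "m = j + int n - s"
        have ms: "m + s = j + int n" by (simp add: m_def)
        have ab: "a \<le> m" "m < b" using lt False j by (auto simp: m_def)
        have agree: "x i = y i" if "m + r \<le> i" "i < m + s" for i
        proof -
          have "i = j + int (nat (i - j))" "nat (i - j) < n"
            using that False by (auto simp: m_def)
          then show ?thesis using less[of "nat (i - j)"] lt by auto
        qed
        have "F (y(m + s := x (m + s))) m = F x m"
          by (rule F_local) (use agree in \<open>auto simp: not_less\<close>)
        also have "\<dots> = F (y(m + s := y (m + s))) m" using F ab by simp
        finally have "x (m + s) = y (m + s)" using F_right[of y m] by metis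
        then show "x (j + int n) = y (j + int n)" by (simp add: ms)
      qed
    qed
  qed
  from this[of "nat (i - j)"] i show ?thesis by simp
qed

text \<open>The mirror image of \<open>determined_right\<close>: the induction runs to the left from
  \<open>J\<close>, the last cell of the known block.\<close>

lemma determined_left:
  assumes win: "\<And>i. j \<le> i \<Longrightarrow> i < j + (s - r) \<Longrightarrow> x i = y i"
    and F: "\<And>m. a \<le> m \<Longrightarrow> m < b \<Longrightarrow> F x m = F y m"
    and j: "j - r \<le> b" and i: "a + r \<le> i" "i < j + (s - r)"
  shows "x i = y i"
proof -
  define J where "J = j + (s - r) - 1"
  have "a + r \<le> J - int n \<longrightarrow> x (J - int n) = y (J - int n)" for n
  proof (induction n rule: less_induct)
    case (less n)
    show ?case
    proof (cases "int n < s - r")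
      case True
      then show ?thesis using win by (simp add: J_def)
    next
      case False
      show ?thesis
      proof
        assume ge: "a + r \<le> J - int n"
        define m where "m = J - int n - r"
        have mr: "m + r = J - int n" by (simp add: m_def)
        have ab: "a \<le> m" "m < b" using ge False j by (auto simp: m_def J_def)
        have agree: "x i = y i" if "m + r < i" "i \<le> m + s" for i
        proof -
          have "i = J - int (nat (J - i))" "nat (J - i) < n"
            using that False by (auto simp: m_def)
          then show ?thesis using less[of "nat (J - i)"] ge by auto
        qed
        have "F (y(m + r := x (m + r))) m = F x m"
          by (rule F_local) (use agree in \<open>auto simp: not_less\<close>)
        also have "\<dots> = F (y(m + r := y (m + r))) m" using F ab by simp
        finally have "x (m + r) = y (m + r)" using F_left[of y m] by metis
        then show "x (J - int n) = y (J - int n)" by (simp add: mr)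
      qed
    qed
  qed
  from this[of "nat (J - i)"] i show ?thesis by (simp add: J_def)
qed

lemma determined:
  assumes win: "\<And>i. j \<le> i \<Longrightarrow> i < j + (s - r) \<Longrightarrow> x i = y i"
    and F: "\<And>m. a \<le> m \<Longrightarrow> m < b \<Longrightarrow> F x m = F y m"
    and j: "a + r \<le> j" "j - r \<le> b" and i: "a + r \<le> i" "i < b + s"
  shows "x i = y i"
  using determined_right[OF win F j(1)] determined_left[OF win F j(2)] i r_less_s
  by (cases "j \<le> i") auto

lemma fibre_determined:
  assumes win: "\<And>i. 0 \<le> i \<Longrightarrow> i < s - r \<Longrightarrow> x i = y i" and F: "F x = F y"
  shows "x = y"
proof
  fix i show "x i = y i"
    by (rule determined[of 0 x y "- \<bar>i\<bar> - \<bar>r\<bar>" "\<bar>i\<bar> + \<bar>r\<bar> + \<bar>s\<bar> + 1"]) (use win F in auto)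
qed

text \<open>Finitely many values of \<open>F\<close> can be prescribed by solving for one new
  coordinate at a time, alternately on the right and on the left of the given block; compactness
  gives all values at once.\<close>

lemma fibre_exists: "\<exists>x. (\<forall>i\<in>{0..<s - r}. x i = z i) \<and> F x = y"
proof -
  \<comment> \<open>The cell - r has the window [0, s - r], so it is the first one to see a new
    coordinate to the right of the block; the cell - r - 1 is the first one to do so on the left.
    Hence the constraints are centred at - r.\<close>
  define X where "X n = {x. (\<forall>i\<in>{0..<s - r}. x i = z i) \<and> (\<forall>m\<in>{- r - int n..<- r + int n}. F x m = y m)}"
    for n
  have "closed (X n)" for n
  proof (rule closed_local_on[where I = "{- int n - (s - r)..int n + (s - r)}"])
    show "local_on {- int n - (s - r)..int n + (s - r)} (X n)"
      unfolding local_on_def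
    proof (intro allI impI)
      fix x x' :: "'a config" assume agree: "\<forall>i\<in>{- int n - (s - r)..int n + (s - r)}. x i = x' i"
      have "F x m = F x' m" if "m \<in> {- r - int n..<- r + int n}" for m
        by (rule F_local) (use agree that r_less_s in auto)
      moreover have "x i = x' i" if "i \<in> {0..<s - r}" for i using agree that by auto
      ultimately show "x \<in> X n \<longleftrightarrow> x' \<in> X n" by (auto simp: X_def)
    qed
  qed simp
  moreover have "X n \<noteq> {}" for n
  proof (induction n)
    case 0
    have "z \<in> X 0" by (simp add: X_def)
    then show ?case by blast
  next
    case (Suc n)
    then obtain x where x: "x \<in> X n" by blast
    define m1 where "m1 = - r + int n"
    define m2 where "m2 = - r - int n - 1"
    obtain a where a: "F (x(m1 + s := a)) m1 = y m1" using F_right by blast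
    define x1 where "x1 = x(m1 + s := a)"
    obtain a' where a': "F (x1(m2 + r := a')) m2 = y m2" using F_left by blast
    define x2 where "x2 = x1(m2 + r := a')"
    have "F x2 m = y m" if m: "m \<in> {- r - int (Suc n)..<- r + int (Suc n)}" for m
    proof -
      consider "m = m1" | "m = m2" | "m \<in> {- r - int n..<- r + int n}"
        using m by (auto simp: m1_def m2_def) linarith
      then show ?thesis
      proof cases
        case 1
        have "F x2 m1 = F x1 m1" by (rule F_local) (auto simp: x2_def m1_def m2_def)
        then show ?thesis using a 1 by (simp add: x1_def)
      next
        case 2 then show ?thesis using a' by (simp add: x2_def)
      next
        case 3
        have "F x2 m = F x m" by (rule F_local) (use 3 in \<open>auto simp: x2_def x1_def m1_def m2_def\<close>)
        then show ?thesis using x 3 by (simp add: X_def)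
      qed
    qed
    moreover have "x2 i = z i" if "i \<in> {0..<s - r}" for i
      using that x by (auto simp: x2_def x1_def m1_def m2_def X_def)
    ultimately have "x2 \<in> X (Suc n)" unfolding X_def by blast
    then show ?case by blast
  qed
  moreover have "decseq X" by (auto simp: decseq_def X_def)
  ultimately obtain x where x: "\<And>n. x \<in> X n" using decseq_closed_Inter_nonempty[of X] by blast
  have "F x m = y m" for m
  proof -
    have "m \<in> {- r - int (nat \<bar>m + r\<bar> + 1)..<- r + int (nat \<bar>m + r\<bar> + 1)}" by auto
    then show ?thesis using x[of "nat \<bar>m + r\<bar> + 1"] unfolding X_def by blast
  qed
  then show ?thesis using x[of 0] by (auto simp: X_def)
qed

text \<open>Points of a fibre correspond to words on the block [0, s - r). For the fibre of the
  identity this gives the order of the kernel, whose prime factors are therefore those of the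
  alphabet size.\<close>

lemma card_fibre: "card {x. F x = y} = CARD('a) ^ nat (s - r)"
proof -
  have "bij_betw (\<lambda>x. restrict x {0..<s - r}) {x. F x = y} ({0..<s - r} \<rightarrow>\<^sub>E UNIV)"
  proof (rule bij_betwI')
    fix x x' assume "x \<in> {x. F x = y}" "x' \<in> {x. F x = y}"
    then show "restrict x {0..<s - r} = restrict x' {0..<s - r} \<longleftrightarrow> x = x'"
      using fibre_determined[of x x'] by (auto simp: restrict_def fun_eq_iff split: if_splits)
  next
    fix u assume "u \<in> {0..<s - r} \<rightarrow>\<^sub>E (UNIV :: 'a discrete set)"
    moreover obtain x where "\<forall>i\<in>{0..<s - r}. x i = u i" "F x = y" using fibre_exists by blast
    ultimately show "\<exists>x\<in>{x. F x = y}. u = restrict x {0..<s - r}"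
      by (intro bexI[of _ x]) (auto simp: fun_eq_iff PiE_iff extensional_def)
  qed auto
  then have "card {x. F x = y} = card ({0..<s - r} \<rightarrow>\<^sub>E (UNIV :: 'a discrete set))"
    by (rule bij_betw_same_card)
  then show ?thesis by (simp add: card_PiE card_UNIV_discrete)
qed

lemma finite_fibre: "finite {x. F x = y}"
  using card_fibre[of y] by (metis card.infinite finite power_not_zero zero_less_card_finite less_numeral_extra(3))

end

section \<open>Vanishing entropy\<close>

definition window :: "int \<Rightarrow> int \<Rightarrow> 'a config \<Rightarrow> 'a discrete list" where
  "window a b x = map x [a..b - 1]"

lemma window_eq_iff: "window a b x = window a b y \<longleftrightarrow> (\<forall>i. a \<le> i \<longrightarrow> i < b \<longrightarrow> x i = y i)"
  by (auto simp: window_def)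

lemma shift_map_power: "(shift_map ^^ n) x i = x (i + int n)"
  by (induction n arbitrary: i) (simp_all add: shift_map_def algebra_simps)

locale bipermutative_measure = bipermutative_rule F r s + measure_preserving M F +
    shift: measure_preserving M shift_map
  for F :: "'a::finite config \<Rightarrow> 'a config" and r s M +
  assumes sets_M: "sets M = sets borel" and F_shift: "F (shift_map x) = shift_map (F x)"
begin

lemma space_M [simp]: "space M = UNIV"
  using sets_eq_imp_space_eq[OF sets_M] by simp

lemma UNIV_in_sets [simp]: "UNIV \<in> sets M"
  using sets.top[of M] by simp

lemma F_shift_power: "F ((shift_map ^^ n) x) = (shift_map ^^ n) (F x)"
  by (induction n arbitrary: x) (simp_all add: F_shift)

lemma simple_function_coordinate: "simple_function M (\<lambda>x. x i)"
  unfolding simple_function_def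
proof (intro conjI ballI)
  show "finite ((\<lambda>x. x i) ` space M)" by (rule finite_subset[OF _ finite_UNIV_discrete]) simp
  fix c :: "'a discrete"
  have "(\<lambda>x. x i) -` {c} = {x. x i = c}" by auto
  then show "(\<lambda>x. x i) -` {c} \<inter> space M \<in> sets M"
    using open_coordinate[of "\<lambda>a. a = c" i] by (simp add: sets_M)
qed

lemma simple_function_window [intro, simp]: "simple_function M (window a b)"
  unfolding window_def by (intro simple_function_map simple_function_coordinate)

lemma simple_function_window_F [intro, simp]: "simple_function M (\<lambda>x. window a b (F x))"
  using simple_function_compose_Tn[OF simple_function_window, where n = 1] by simp

lemma ent_window_shift: "ent M (window (a + c) (b + c)) = ent M (window a b)"
proof -
  have nonneg: "ent M (window (a + int n) (b + int n)) = ent M (window a b)" for a b n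
  proof -
    have eq: "(\<forall>i. a + int n \<le> i \<longrightarrow> i < b + int n \<longrightarrow> x i = y i) \<longleftrightarrow>
        (\<forall>i. a \<le> i \<longrightarrow> i < b \<longrightarrow> x (i + int n) = y (i + int n))" for x y :: "'a config"
    proof (intro iffI allI impI)
      fix i assume "\<forall>i. a \<le> i \<longrightarrow> i < b \<longrightarrow> x (i + int n) = y (i + int n)" "a + int n \<le> i" "i < b + int n"
      then show "x i = y i" by (drule_tac x = "i - int n" in spec) simp
    qed simp
    have "ent M (window (a + int n) (b + int n)) = ent M (\<lambda>x. window a b ((shift_map ^^ n) x))"
      by (rule ent_cong) (simp add: window_eq_iff shift_map_power eq)
    then show ?thesis by (simp add: shift.ent_compose)
  qed
  show ?thesis
  proof (cases "c \<ge> 0")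
    case True
    then show ?thesis using nonneg[of a "nat c" b] by simp
  next
    case False
    then show ?thesis using nonneg[of "a + c" "nat (- c)" "b + c"] by simp
  qed
qed

abbreviation window_ent :: "nat \<Rightarrow> real" where
  "window_ent L \<equiv> ent M (window 0 (int L))"

lemma ent_window: "a \<le> b \<Longrightarrow> ent M (window a b) = window_ent (nat (b - a))"
  using ent_window_shift[of 0 a "b - a"] by simp

lemma window_ent_mono: "L \<le> L' \<Longrightarrow> window_ent L \<le> window_ent L'"
  by (rule ent_mono) (auto simp: window_eq_iff)

lemma cond_ent_window_small:
  assumes Q: "simple_function M Q" and e: "e > 0"
  shows "\<exists>N. cond_ent M Q (window (- int N) (int N + 1)) < e"
proof (rule cond_ent_small[OF Q _ _ _ e])
  fix v and d :: real assume "d > 0"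
  then obtain N C where C: "local_on {- int N..int N} C" "measure M (sym_diff (Q -` {v} \<inter> space M) C) < d"
    using borel_approx_local[OF prob_space_axioms sets_M simple_functionD(2)[OF Q]] by blast
  have "x \<in> C \<longleftrightarrow> y \<in> C" if "window (- int N) (int N + 1) x = window (- int N) (int N + 1) y" for x y
    using C(1) that by (auto simp: local_on_def window_eq_iff)
  moreover have "C \<in> sets M" by (rule sets_local_on[OF sets_M _ C(1)]) simp
  ultimately show "\<exists>N. \<exists>C\<in>sets M. (\<forall>x y. window (- int N) (int N + 1) x = window (- int N) (int N + 1) y
      \<longrightarrow> (x \<in> C \<longleftrightarrow> y \<in> C)) \<and> prob (sym_diff (Q -` {v} \<inter> space M) C) < d"
    using C(2) by blast
qed (auto simp: window_eq_iff)

text \<open>\<open>near_inj\<close> expresses injectivity of \<open>F\<close> modulo the measure: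
  sets defined by one coordinate are nearly preimages under \<open>F\<close>. Half of
  \<open>d\<close> pays for this, the other half for replacing \<open>C\<close> by a local set, at
  the same cost after pulling back since \<open>F\<close> preserves the measure.\<close>

lemma cond_ent_coordinate_small:
  assumes near_inj: "\<forall>c. \<forall>d>0. \<exists>C\<in>sets M. measure M (sym_diff (F -` C) {x. x 0 = c}) < d"
    and e: "e > 0"
  shows "\<exists>N. cond_ent M (\<lambda>x. x 0) (\<lambda>x. window (- int N) (int N + 1) (F x)) < e"
proof (rule cond_ent_small[OF simple_function_coordinate _ _ _ e])
  fix v and d :: real assume d: "d > 0"
  then obtain C where C: "C \<in> sets M" "measure M (sym_diff (F -` C) {x. x 0 = v}) < d / 2"
    using near_inj d by (meson half_gt_zero)
  obtain N C' where C': "local_on {- int N..int N} C'" "measure M (sym_diff C C') < d / 2"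
    using borel_approx_local[OF prob_space_axioms sets_M C(1), of "d / 2"] d by auto
  have C's: "C' \<in> sets M" by (rule sets_local_on[OF sets_M _ C'(1)]) simp
  have F: "F -` A \<in> sets M" if "A \<in> sets M" for A
    using measurable_sets[OF T_measurable that] by simp
  have vs: "{x. x 0 = v} \<in> sets M"
    using open_coordinate[of "\<lambda>a. a = v" 0] by (simp add: sets_M)
  let ?D = "sym_diff (F -` C) {x. x 0 = v}" and ?E = "F -` sym_diff C C'"
  have D: "?D \<in> sets M" by (intro sets.Un sets.Diff F C(1) vs)
  have E: "?E \<in> sets M" by (intro sets.Un sets.Diff F C(1) C's)
  have "prob (sym_diff ((\<lambda>x. x 0) -` {v} \<inter> space M) (F -` C')) \<le> prob (?D \<union> ?E)"
    by (rule finite_measure_mono) (use D E in auto)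
  also have "\<dots> \<le> prob ?D + prob ?E" by (rule measure_Un_le[OF D E])
  also have "prob ?E = prob (sym_diff C C')"
    using prob_vimage_Tn[of "sym_diff C C'" 1] C C's by auto
  also have "prob ?D + prob (sym_diff C C') < d" using C(2) C'(2) by simp
  finally have "prob (sym_diff ((\<lambda>x. x 0) -` {v} \<inter> space M) (F -` C')) < d" .
  moreover have "x \<in> F -` C' \<longleftrightarrow> y \<in> F -` C'"
    if "window (- int N) (int N + 1) (F x) = window (- int N) (int N + 1) (F y)" for x y
    using C'(1) that by (auto simp: local_on_def window_eq_iff)
  ultimately show "\<exists>N. \<exists>C\<in>sets M. (\<forall>x y. window (- int N) (int N + 1) (F x) = window (- int N) (int N + 1) (F y)
      \<longrightarrow> (x \<in> C \<longleftrightarrow> y \<in> C)) \<and> prob (sym_diff ((\<lambda>x. x 0) -` {v} \<inter> space M) C) < d"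
    using F[OF C's] by blast
qed (auto simp: window_eq_iff)

text \<open>A window of length \<open>L + w\<close> of \<open>x\<close>, where \<open>w = s - r\<close>, is determined by the window of length \<open>L\<close>
  of \<open>F x\<close>, which has entropy \<open>window_ent L\<close>, and by \<open>w\<close> coordinates of \<open>x\<close> in its middle.\<close>

lemma window_ent_step:
  fixes e :: real
  assumes near_inj: "\<forall>c. \<forall>d>0. \<exists>C\<in>sets M. measure M (sym_diff (F -` C) {x. x 0 = c}) < d"
    and e: "e > 0"
  shows "\<exists>L0. \<forall>L\<ge>L0. window_ent (L + nat (s - r)) \<le> window_ent L + nat (s - r) * e"
proof -
  obtain N where N: "cond_ent M (\<lambda>x. x 0) (\<lambda>x. window (- int N) (int N + 1) (F x)) < e"
    using cond_ent_coordinate_small[OF near_inj e] by blast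
  define w where "w = s - r"
  have w: "w > 0" using r_less_s by (simp add: w_def)
  \<comment> \<open>From this j on, the windows of radius N around the w cells lie inside [- r, L -
    r) once L \<ge> \<open>L0\<close>. Knowing \<open>F x\<close> on [- r, L - r) and
    \<open>x\<close> on these cells determines \<open>x\<close> on [0, L + w).\<close>
  define j where "j = int N + \<bar>r\<bar>"
  define L0 where "L0 = nat (2 * int N + 2 * \<bar>r\<bar> + w)"
  have "window_ent (L + nat w) \<le> window_ent L + nat w * e" if L: "L \<ge> L0" for L
  proof -
    have L': "int L \<ge> 2 * int N + 2 * \<bar>r\<bar> + w" using L by (simp add: L0_def)
    let ?J = "window j (j + w)" and ?Y = "\<lambda>x. window (- r) (int L - r) (F x)"
    have sJ: "simple_function M (\<lambda>x. (?J x, ?Y x))" by (intro simple_function_Pair) auto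
    have "window_ent (L + nat w) \<le> ent M (\<lambda>x. (?J x, ?Y x))"
    proof (rule ent_mono[OF sJ])
      fix x y :: "'a config" assume "(?J x, ?Y x) = (?J y, ?Y y)"
      then have J: "\<And>i. j \<le> i \<Longrightarrow> i < j + (s - r) \<Longrightarrow> x i = y i"
        and Y: "\<And>m. - r \<le> m \<Longrightarrow> m < int L - r \<Longrightarrow> F x m = F y m"
        by (auto simp: window_eq_iff w_def)
      have "x i = y i" if "0 \<le> i" "i < int (L + nat w)" for i
        by (rule determined[OF J Y]) (use that L' w in \<open>auto simp: j_def w_def\<close>)
      then show "window 0 (int (L + nat w)) x = window 0 (int (L + nat w)) y"
        by (auto simp: window_eq_iff)
    qed auto
    also have "\<dots> = ent M ?Y + cond_ent M ?J ?Y" by (simp add: cond_ent_def)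
    also have "ent M ?Y = window_ent L"
      using ent_compose[OF simple_function_window, of "- r" "int L - r" 1]
        ent_window_shift[of 0 "- r" "int L"] by simp
    also have "cond_ent M ?J ?Y \<le> (\<Sum>i\<leftarrow>[j..j + w - 1]. cond_ent M (\<lambda>x. x i) ?Y)"
      unfolding window_def[of j] by (rule cond_ent_map_le) (auto intro: simple_function_coordinate)
    also have "\<dots> \<le> (\<Sum>i\<leftarrow>[j..j + w - 1]. e)"
    proof (rule sum_list_mono)
      fix i assume "i \<in> set [j..j + w - 1]"
      then have i: "j \<le> i" "i < j + w" by auto
      have i0: "i \<ge> 0" using i by (simp add: j_def)
      let ?W = "\<lambda>x. window (i - int N) (i + int N + 1) (F x)"
      have "cond_ent M (\<lambda>x. x i) ?Y \<le> cond_ent M (\<lambda>x. x i) ?W"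
        by (rule cond_ent_mono) (use i L' in \<open>auto simp: window_eq_iff j_def intro: simple_function_coordinate\<close>)
      also have "\<dots> = cond_ent M (\<lambda>x. ((shift_map ^^ nat i) x) 0)
          (\<lambda>x. window (- int N) (int N + 1) (F ((shift_map ^^ nat i) x)))"
      proof -
        have eq: "(\<forall>k\<ge>i - int N. k \<le> i + int N \<longrightarrow> F x k = F y k) \<longleftrightarrow>
          (\<forall>k\<ge>- int N. k \<le> int N \<longrightarrow> F x (k + i) = F y (k + i))" for x y
        proof (intro iffI allI impI)
          fix k assume "\<forall>k\<ge>- int N. k \<le> int N \<longrightarrow> F x (k + i) = F y (k + i)"
            "i - int N \<le> k" "k \<le> i + int N"
          then show "F x k = F y k" by (drule_tac x = "k - i" in spec) simp
        qed simp
        have "ent M ?W = ent M (\<lambda>x. window (- int N) (int N + 1) (F ((shift_map ^^ nat i) x)))"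
          by (rule ent_cong) (use i0 in \<open>simp add: window_eq_iff F_shift_power shift_map_power eq\<close>)
        moreover have "ent M (\<lambda>x. (x i, ?W x)) = ent M (\<lambda>x. (((shift_map ^^ nat i) x) 0,
            window (- int N) (int N + 1) (F ((shift_map ^^ nat i) x))))"
          by (rule ent_cong) (use i0 in \<open>simp add: window_eq_iff F_shift_power shift_map_power eq\<close>)
        ultimately show ?thesis by (simp add: cond_ent_def)
      qed
      also have "\<dots> = cond_ent M (\<lambda>x. x 0) (\<lambda>x. window (- int N) (int N + 1) (F x))"
        by (rule shift.cond_ent_compose) (auto intro: simple_function_coordinate)
      finally show "cond_ent M (\<lambda>x. x i) ?Y \<le> e" using N by simp
    qed
    also have "\<dots> = nat w * e" by (simp add: sum_list_triv)
    finally show ?thesis by simp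
  qed
  then show ?thesis unfolding w_def by blast
qed

text \<open>Each application of the step adds w cells at cost w e; the constant absorbs the windows
  shorter than \<open>L0 + w\<close>.\<close>

lemma window_ent_sublinear:
  fixes e :: real
  assumes near_inj: "\<forall>c. \<forall>d>0. \<exists>C\<in>sets M. measure M (sym_diff (F -` C) {x. x 0 = c}) < d"
    and e: "e > 0"
  shows "\<exists>K::real. \<forall>L. window_ent L \<le> K + L * e"
proof -
  define w where "w = nat (s - r)"
  have w: "w > 0" using r_less_s by (simp add: w_def)
  obtain L0 where L0: "\<And>L. L \<ge> L0 \<Longrightarrow> window_ent (L + w) \<le> window_ent L + w * e"
    using window_ent_step[OF near_inj e] unfolding w_def by blast
  have "window_ent L \<le> window_ent (L0 + w) + L * e" for L
  proof (induction L rule: less_induct)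
    case (less L)
    show ?case
    proof (cases "L < L0 + w")
      case True
      then have "window_ent L \<le> window_ent (L0 + w)" by (intro window_ent_mono) simp
      moreover have "0 \<le> L * e" using e by simp
      ultimately show ?thesis by linarith
    next
      case False
      then obtain L' where L': "L = L' + w" "L0 \<le> L'" by (metis add_le_imp_le_right le_add2 le_add_diff_inverse2 not_less order_trans)
      have "window_ent L \<le> window_ent L' + w * e" using L0[OF L'(2)] L'(1) by simp
      moreover have "window_ent L' \<le> window_ent (L0 + w) + L' * e" using less L' w by simp
      ultimately show ?thesis using L'(1) by (simp add: algebra_simps)
    qed
  qed
  then show ?thesis by blast
qed

lemma F_power_agree:
  assumes "\<And>i. a - int n * (\<bar>r\<bar> + \<bar>s\<bar>) \<le> i \<Longrightarrow> i < b + int n * (\<bar>r\<bar> + \<bar>s\<bar>) \<Longrightarrow> x i = y i"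
    and "a \<le> m" "m < b"
  shows "(F ^^ n) x m = (F ^^ n) y m"
  using assms
proof (induction n arbitrary: a b m)
  case (Suc n)
  have "(F ^^ n) x i = (F ^^ n) y i" if "m + r \<le> i" "i \<le> m + s" for i
    by (rule Suc.IH[of "a - (\<bar>r\<bar> + \<bar>s\<bar>)" "b + (\<bar>r\<bar> + \<bar>s\<bar>)"])
      (use Suc.prems that in \<open>auto simp: algebra_simps\<close>)
  then show ?case using F_local[of m "(F ^^ n) x" "(F ^^ n) y"] by simp
qed simp

text \<open>A light cone argument: \<open>Q\<close> is nearly determined by a window of radius N,
  and that window of \<open>(F ^^ i) x\<close>, i < n, by the window of \<open>x\<close> of radius N
  + n C. Its length is linear in n, so its entropy is small compared with n.\<close>

lemma orbit_ent_sublinear: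
  assumes near_inj: "\<forall>c. \<forall>d>0. \<exists>C\<in>sets M. measure M (sym_diff (F -` C) {x. x 0 = c}) < d"
    and Q: "simple_function M Q"
  shows "(\<lambda>n. ent M (\<lambda>x. map (\<lambda>i. Q ((F ^^ i) x)) [0..<n]) / n) \<longlonglongrightarrow> 0"
proof (rule tendstoI)
  fix e :: real assume e: "e > 0"
  define C where "C = nat (\<bar>r\<bar> + \<bar>s\<bar>)"
  have C: "int C = \<bar>r\<bar> + \<bar>s\<bar>" by (simp add: C_def)
  \<comment> \<open>The factor 2 C + 1 collects 2 C cells per iterate from the two sides of the
    light cone and one conditional entropy per iterate. The total is e / 2 per iterate, leaving room
    for a constant divided by n.\<close>
  define e' where "e' = e / (2 * (2 * real C + 1))"
  have e': "e' > 0" using e by (simp add: e'_def)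
  obtain N where N: "cond_ent M Q (window (- int N) (int N + 1)) < e'"
    using cond_ent_window_small[OF Q e'] by blast
  obtain K where K: "\<And>L. window_ent L \<le> K + L * e'"
    using window_ent_sublinear[OF near_inj e'] by blast
  let ?X = "\<lambda>n x. map (\<lambda>i. Q ((F ^^ i) x)) [0..<n]"
  have bound: "ent M (?X n) \<le> K + (2 * N + 1) * e' + n * (e / 2)" for n
  proof -
    define b where "b = int N + 1 + int n * int C"
    define a where "a = - int N - int n * int C"
    let ?W = "window a b"
    have sX: "simple_function M (?X n)"
      by (intro simple_function_map simple_function_compose_Tn Q)
    have "ent M (?X n) \<le> ent M (\<lambda>x. (?X n x, ?W x))"
      by (rule ent_mono) (auto intro!: simple_function_Pair sX simp del: map_eq_conv)
    also have "\<dots> = ent M ?W + cond_ent M (?X n) ?W" by (simp add: cond_ent_def)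
    also have "cond_ent M (?X n) ?W \<le> (\<Sum>i\<leftarrow>[0..<n]. cond_ent M (\<lambda>x. Q ((F ^^ i) x)) ?W)"
      by (rule cond_ent_map_le) (auto intro: simple_function_compose_Tn Q)
    also have "\<dots> \<le> (\<Sum>i\<leftarrow>[0..<n]. e')"
    proof (rule sum_list_mono)
      fix i assume "i \<in> set [0..<n]"
      then have i: "i \<le> n" by simp
      have "cond_ent M (\<lambda>x. Q ((F ^^ i) x)) ?W \<le>
          cond_ent M (\<lambda>x. Q ((F ^^ i) x)) (\<lambda>x. window (- int N) (int N + 1) ((F ^^ i) x))"
      proof (rule cond_ent_mono[OF simple_function_compose_Tn[OF Q] simple_function_window
            simple_function_compose_Tn[OF simple_function_window]])
        fix x y :: "'a config" assume "?W x = ?W y"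
        then have agree: "x k = y k" if "a \<le> k" "k < b" for k using that by (simp add: window_eq_iff)
        have "int i * int C \<le> int n * int C" using i by (simp add: mult_right_mono)
        then have "(F ^^ i) x m = (F ^^ i) y m" if "- int N \<le> m" "m < int N + 1" for m
          by (intro F_power_agree[of "- int N" i "int N + 1"] agree)
            (use that in \<open>auto simp: a_def b_def C[symmetric]\<close>)
        then show "window (- int N) (int N + 1) ((F ^^ i) x) = window (- int N) (int N + 1) ((F ^^ i) y)"
          by (simp add: window_eq_iff)
      qed
      also have "\<dots> = cond_ent M Q (window (- int N) (int N + 1))"
        by (rule cond_ent_compose[OF Q simple_function_window])
      finally show "cond_ent M (\<lambda>x. Q ((F ^^ i) x)) ?W \<le> e'" using N by simp
    qed
    also have "\<dots> = n * e'" by (simp add: sum_list_triv)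
    also have "ent M ?W = window_ent (2 * N + 1 + 2 * n * C)"
    proof -
      have "a \<le> b" by (simp add: a_def b_def)
      moreover have "nat (b - a) = 2 * N + 1 + 2 * n * C"
        by (simp add: a_def b_def nat_eq_iff algebra_simps)
      ultimately show ?thesis using ent_window by metis
    qed
    also have "\<dots> \<le> K + (2 * N + 1 + 2 * n * C) * e'" using K by blast
    finally have "ent M (?X n) \<le> K + (2 * N + 1 + 2 * n * C) * e' + n * e'" by simp
    also have "\<dots> = K + (2 * N + 1) * e' + n * (e' * (2 * real C + 1))" by (simp add: algebra_simps)
    also have "e' * (2 * real C + 1) = e / 2"
    proof -
      have "2 * real C + 1 \<noteq> 0" by linarith
      then show ?thesis unfolding e'_def by (metis divide_divide_eq_left nonzero_eq_divide_eq)
    qed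
    finally show ?thesis .
  qed
  have "(\<lambda>n. (K + (2 * N + 1) * e') / n + e / 2) \<longlonglongrightarrow> 0 + e / 2"
    by (intro tendsto_add tendsto_const lim_const_over_n)
  then have "eventually (\<lambda>n. (K + (2 * N + 1) * e') / n + e / 2 < e) sequentially"
    by (rule order_tendstoD(2)) (use e in simp)
  then show "eventually (\<lambda>n. dist (ent M (?X n) / n) 0 < e) sequentially"
    using eventually_gt_at_top[of 0]
  proof eventually_elim
    case (elim n)
    have "ent M (?X n) / n \<le> (K + (2 * N + 1) * e' + n * (e / 2)) / n"
      using bound by (rule divide_right_mono) simp
    also have "\<dots> = (K + (2 * N + 1) * e') / n + e / 2" using elim(2) by (simp add: field_simps)
    finally show ?case using elim(1) ent_nonneg[of "?X n"] by simp
  qed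
qed

lemma KS_entropy_nonpos:
  assumes near_inj: "\<forall>c. \<forall>d>0. \<exists>C\<in>sets M. measure M (sym_diff (F -` C) {x. x 0 = c}) < d"
  shows "KS_entropy M F \<le> 0"
  unfolding KS_entropy_def
proof (rule SUP_least)
  fix P assume "P \<in> {P. finite_partition M P}"
  then have P: "finite_partition M P" by simp
  have "(\<lambda>n. ent M (\<lambda>x. map (\<lambda>i. cell P ((F ^^ i) x)) [0..<n]) / n) \<longlonglongrightarrow> 0"
    by (rule orbit_ent_sublinear[OF near_inj simple_function_cell[OF P]])
  moreover have "eventually (\<lambda>n. ent M (\<lambda>x. map (\<lambda>i. cell P ((F ^^ i) x)) [0..<n]) / n =
      partition_entropy M (iterated_partition M F P n) / n) sequentially"
    using eventually_gt_at_top[of 0]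
  proof eventually_elim
    case (elim n)
    then show ?case
      using iterated_partition_eq[OF P _ elim, of F]
        partition_entropy_fibres[of "\<lambda>x. map (\<lambda>i. cell P ((F ^^ i) x)) [0..<n]"] by simp
  qed
  ultimately have "(\<lambda>n. partition_entropy M (iterated_partition M F P n) / n) \<longlonglongrightarrow> 0"
    by (rule Lim_transform_eventually)
  then show "ereal (entropy_wrt_partition M F P) \<le> 0"
    by (simp add: entropy_wrt_partition_def limI)
qed

end

section \<open>Kernels of the iterates\<close>

definition unshift_map :: "'a config \<Rightarrow> 'a config" where
  "unshift_map x = (\<lambda>i. x (i - 1))"

lemma shift_unshift [simp]: "shift_map (unshift_map x) = x" "unshift_map (shift_map x) = x"
  by (simp_all add: shift_map_def unshift_map_def)

lemma inj_shift_map: "inj shift_map"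
  by (metis injI shift_unshift(2))

lemma continuous_on_unshift_map: "continuous_on UNIV unshift_map"
  unfolding unshift_map_def by (intro continuous_on_coordinatewise_then_product) simp

text \<open>Injectivity makes every finite orbit periodic, and the product of the individual periods
  serves all points.\<close>

lemma finite_common_period:
  assumes "finite K" "inj f" "f ` K \<subseteq> K"
  shows "\<exists>p>0. \<forall>x\<in>K. (f ^^ p) x = x"
proof -
  have mem: "(f ^^ n) x \<in> K" if "x \<in> K" for x n
    using that assms(3) by (induction n) auto
  have "\<exists>n>0. (f ^^ n) x = x" if "x \<in> K" for x
  proof -
    have "finite {y. \<exists>n. y = (f ^^ n) x}"
      by (rule finite_subset[OF _ assms(1)]) (use mem[OF that] in auto)
    then show ?thesis using funpow_inj_finite[OF assms(2)] by metis
  qed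
  then obtain n where n: "\<And>x. x \<in> K \<Longrightarrow> n x > 0" "\<And>x. x \<in> K \<Longrightarrow> (f ^^ n x) x = x" by metis
  have "(f ^^ prod n K) x = x" if "x \<in> K" for x
  proof -
    obtain j where j: "prod n K = n x * j" using dvd_prodI[OF assms(1) \<open>x \<in> K\<close>, of n] by blast
    have "((f ^^ n x) ^^ j) x = x" by (induction j) (use n that in auto)
    then show ?thesis by (simp add: j funpow_mult)
  qed
  moreover have "prod n K > 0" using n(1) by (intro prod_pos) auto
  ultimately show ?thesis by blast
qed

locale algebraic_rule = comm_group G + bipermutative_rule F r s
  for G :: "'a::finite config monoid" (structure) and F r s +
  assumes carrier_UNIV: "carrier G = UNIV"
    and continuous_mult: "continuous_on UNIV (\<lambda>(x, y). x \<otimes> y)"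
    and shift_hom: "shift_map \<in> hom G G" and F_hom: "F \<in> hom G G"
    and F_commutes_shift: "F (shift_map x) = shift_map (F x)"
begin

lemma mem_carrier [simp]: "x \<in> carrier G" by (simp add: carrier_UNIV)

lemma hom_funpow:
  assumes "h \<in> hom G G" shows "(h ^^ n) \<in> hom G G"
  using assms by (induction n) (auto simp: hom_def)

lemma hom_mult_eq: "h \<in> hom G G \<Longrightarrow> h (x \<otimes> y) = h x \<otimes> h y"
  by (simp add: hom_def)

lemma hom_one_eq: "h \<in> hom G G \<Longrightarrow> h \<one> = \<one>"
  using hom_one[OF _ is_group is_group] .

lemma hom_inv_eq: "h \<in> hom G G \<Longrightarrow> h (inv x) = inv (h x)"
  by (metis group_hom.hom_inv group_hom.intro group_hom_axioms.intro is_group mem_carrier)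

lemma hom_pow_eq:
  assumes "h \<in> hom G G" shows "h (x [^] (n::nat)) = h x [^] n"
  by (induction n) (simp_all add: hom_one_eq[OF assms] hom_mult_eq[OF assms])

definition K where "K n = kernel G G (F ^^ n)"

lemma K_iff: "x \<in> K n \<longleftrightarrow> (F ^^ n) x = \<one>" by (simp add: K_def kernel_def)

lemma K_Suc_iff: "x \<in> K (Suc n) \<longleftrightarrow> F x \<in> K n"
  by (simp add: K_iff funpow_swap1)

lemma K_mono: "m \<le> n \<Longrightarrow> K m \<subseteq> K n"
  using hom_one_eq[OF hom_funpow[OF F_hom]]
  by (auto simp: K_iff le_iff_add funpow_add add.commute[of m])

lemma finite_K: "finite (K n)"
proof (induction n)
  case 0
  have "K 0 = {\<one>}" by (auto simp: K_iff)
  then show ?case by simp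
next
  case (Suc n)
  have "K (Suc n) = (\<Union>y\<in>K n. {x. F x = y})" by (auto simp: K_Suc_iff)
  then show ?case using Suc finite_fibre by simp
qed

lemma subgroup_K: "subgroup (K n) G"
  unfolding K_def
  by (rule group_hom.subgroup_kernel)
    (simp add: group_hom_def group_hom_axioms_def is_group hom_funpow F_hom)

lemma K1_pow:
  assumes "x \<in> K 1" shows "x [^] (CARD('a) ^ nat (s - r)) = \<one>"
proof -
  interpret K1: group "G\<lparr>carrier := K 1\<rparr>"
    using subgroup_K by (rule subgroup.subgroup_is_group) (rule is_group)
  have "order (G\<lparr>carrier := K 1\<rparr>) = CARD('a) ^ nat (s - r)"
    using card_fibre[of \<one>] by (simp add: order_def K_def kernel_def)
  then have "x [^]\<^bsub>G\<lparr>carrier := K 1\<rparr>\<^esub> (CARD('a) ^ nat (s - r)) = \<one>\<^bsub>G\<lparr>carrier := K 1\<rparr>\<^esub>"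
    using K1.pow_order_eq_1[of x] assms by simp
  then show ?thesis by (simp add: nat_pow_consistent[symmetric])
qed

lemma F_commutes_shift_power: "F ((shift_map ^^ n) x) = (shift_map ^^ n) (F x)"
  by (induction n arbitrary: x) (simp_all add: F_commutes_shift)

lemma shift_power_K: "x \<in> K n \<Longrightarrow> (shift_map ^^ m) x \<in> K n"
proof (induction n arbitrary: x)
  case 0
  then show ?case using hom_one_eq[OF hom_funpow[OF shift_hom]] by (simp add: K_iff)
next
  case (Suc n)
  then show ?case by (simp add: K_Suc_iff F_commutes_shift_power)
qed

text \<open>A common period exists because the kernel is finite and mapped into itself by the shift,
  so the \<open>LEAST\<close> in the definition is attained.\<close>

lemma kernel_period_props:
  "kernel_period G F > 0" "x \<in> K 1 \<Longrightarrow> (shift_map ^^ kernel_period G F) x = x"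
proof -
  have "shift_map ` K 1 \<subseteq> K 1" using shift_power_K[of _ 1 1] by auto
  note finite_common_period[OF finite_K inj_shift_map this]
  moreover have K1: "K 1 = kernel G G F" by (simp add: K_def)
  ultimately have "\<exists>p. 0 < p \<and> (\<forall>x\<in>kernel G G F. (shift_map ^^ p) x = x)" by simp
  from LeastI_ex[OF this]
  show "kernel_period G F > 0" "x \<in> K 1 \<Longrightarrow> (shift_map ^^ kernel_period G F) x = x"
    unfolding kernel_period_def by (simp_all add: K1[simplified])
qed

text \<open>If \<open>S\<close> is a power of the shift which fixes \<open>K (n + 1)\<close> and \<open>x \<in> K (n + 2)\<close>, then \<open>S x\<close> differs
  from \<open>x\<close> by an \<open>S\<close>-fixed element of \<open>K 1\<close>, whose order divides \<open>card (K 1)\<close>.\<close>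

lemma shift_period_K:
  assumes "x \<in> K (Suc n)"
  shows "(shift_map ^^ (kernel_period G F * (CARD('a) ^ nat (s - r)) ^ n)) x = x"
  using assms
proof (induction n arbitrary: x)
  case 0
  then show ?case using kernel_period_props(2) by simp
next
  case (Suc n)
  define p where "p = kernel_period G F"
  define q where "q = CARD('a) ^ nat (s - r)"
  define S where "S = (shift_map :: 'a config \<Rightarrow> _) ^^ (p * q ^ n)"
  have S_hom: "S \<in> hom G G" unfolding S_def by (rule hom_funpow[OF shift_hom])
  have FS: "F (S y) = S (F y)" for y by (simp add: S_def F_commutes_shift_power)
  define y where "y = S x \<otimes> inv x"
  have "S (F x) = F x" unfolding S_def p_def q_def using Suc by (simp add: K_Suc_iff)
  then have "F y = \<one>"
    by (simp add: y_def hom_mult_eq[OF F_hom] hom_inv_eq[OF F_hom] FS)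
  then have y1: "y \<in> K 1" by (simp add: K_iff)
  \<comment> \<open>\<open>y\<close> lies in \<open>K 1\<close> and so has period p; the exponent of
    \<open>S\<close> is a multiple of p.\<close>
  have "((shift_map ^^ p) ^^ j) y = y" for j
    by (induction j) (use kernel_period_props(2)[OF y1] in \<open>simp_all add: p_def\<close>)
  then have Sy: "S y = y" by (simp add: S_def funpow_mult)
  have Sx: "S x = x \<otimes> y" by (simp add: y_def m_assoc[symmetric] m_comm[of x])
      (simp add: m_assoc)
  have "(S ^^ j) x = x \<otimes> y [^] j" for j
  proof (induction j)
    case (Suc j)
    have "(S ^^ Suc j) x = S (x \<otimes> y [^] j)" by (simp add: Suc)
    also have "\<dots> = x \<otimes> y \<otimes> y [^] j"
      by (simp add: hom_mult_eq[OF S_hom] hom_pow_eq[OF S_hom] Sx Sy)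
    also have "\<dots> = x \<otimes> y [^] Suc j" by (simp add: m_assoc m_comm[of y])
    finally show ?case .
  qed simp
  from this[of q] have "(S ^^ q) x = x" using K1_pow[OF y1] by (simp add: q_def)
  then show ?case by (simp add: S_def funpow_mult p_def q_def ac_simps)
qed

lemma continuous_translation: "continuous_on UNIV (\<lambda>x. d \<otimes> x)"
proof -
  have "continuous_on UNIV (\<lambda>x. (\<lambda>(x, y). x \<otimes> y) (d, x))"
    by (rule continuous_on_compose2[OF continuous_mult]) (auto intro!: continuous_intros)
  then show ?thesis by simp
qed

end

section \<open>Haar measure\<close>

context algebraic_rule
begin

lemma translation_measurable:
  assumes "sets M = sets borel" shows "(\<lambda>x. d \<otimes> x) \<in> M \<rightarrow>\<^sub>M M"
proof -
  have "(\<lambda>x. d \<otimes> x) \<in> borel \<rightarrow>\<^sub>M borel"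
    by (rule borel_measurable_continuous_onI[OF continuous_translation])
  then show ?thesis by (simp add: measurable_cong_sets[OF assms assms])
qed

lemma translation_image: "(\<lambda>x. d \<otimes> x) ` B = (\<lambda>x. inv d \<otimes> x) -` B"
proof (intro equalityI subsetI)
  fix y assume "y \<in> (\<lambda>x. inv d \<otimes> x) -` B"
  moreover have "y = d \<otimes> (inv d \<otimes> y)" by (simp add: m_assoc[symmetric])
  ultimately show "y \<in> (\<lambda>x. d \<otimes> x) ` B" by auto
qed (auto simp: m_assoc[symmetric])

text \<open>Passes from images of Borel subsets of \<Sigma>, as in the definition, to preimages of
  arbitrary Borel sets. The measure is carried by \<Sigma>, and translation by g preserves \<Sigma>
  and its complement.\<close>

lemma haar_translation_invariant:
  assumes M: "is_haar_measure G \<Sigma> M" and \<Sigma>: "subgroup \<Sigma> G" "closed \<Sigma>"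
    and g: "g \<in> \<Sigma>" and B: "B \<in> sets borel"
  shows "emeasure M ((\<lambda>x. g \<otimes> x) -` B) = emeasure M B"
proof -
  interpret prob_space M using M by (simp add: is_haar_measure_def borel_probability_def)
  have s: "sets M = sets borel" using M by (simp add: is_haar_measure_def borel_probability_def)
  have sp: "space M = UNIV" using sets_eq_imp_space_eq[OF s] by simp
  have "AE x in M. x \<in> \<Sigma>"
    by (rule AE_prob_1) (use M in \<open>simp add: is_haar_measure_def measure_def\<close>)
  have gB: "(\<lambda>x. g \<otimes> x) -` B \<in> sets M"
    using measurable_sets[OF translation_measurable[OF s], of B] B by (simp add: s sp)
  have \<Sigma>s: "\<Sigma> \<in> sets M" using \<Sigma>(2) s by auto
  have Bs: "B \<in> sets M" using B s by simp
  have "emeasure M ((\<lambda>x. g \<otimes> x) -` B) = emeasure M ((\<lambda>x. g \<otimes> x) -` B \<inter> \<Sigma>)"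
    by (rule emeasure_eq_AE) (use \<open>AE x in M. x \<in> \<Sigma>\<close> gB \<Sigma>s in auto)
  also have "(\<lambda>x. g \<otimes> x) -` B \<inter> \<Sigma> = (\<lambda>x. inv g \<otimes> x) ` (B \<inter> \<Sigma>)"
  proof -
    have "g \<otimes> x \<in> \<Sigma> \<longleftrightarrow> x \<in> \<Sigma>" for x
    proof
      assume "g \<otimes> x \<in> \<Sigma>"
      then have "inv g \<otimes> (g \<otimes> x) \<in> \<Sigma>"
        using \<Sigma>(1) g by (metis subgroup.m_closed subgroup.m_inv_closed)
      then show "x \<in> \<Sigma>" by (simp add: m_assoc[symmetric])
    qed (use \<Sigma>(1) g in \<open>metis subgroup.m_closed\<close>)
    then show ?thesis unfolding translation_image by auto
  qed
  also have "emeasure M \<dots> = emeasure M (B \<inter> \<Sigma>)"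
    using M subgroup.m_inv_closed[OF \<Sigma>(1) g] Bs \<Sigma>s by (simp add: is_haar_measure_def s)
  also have "\<dots> = emeasure M B"
    by (rule emeasure_eq_AE) (use \<open>AE x in M. x \<in> \<Sigma>\<close> Bs \<Sigma>s in auto)
  finally show ?thesis .
qed

text \<open>Both measures equal their convolution.\<close>

lemma haar_unique:
  assumes M: "is_haar_measure G \<Sigma> M" and N: "is_haar_measure G \<Sigma> N"
    and \<Sigma>: "subgroup \<Sigma> G" "closed \<Sigma>"
  shows "M = N"
proof (rule measure_eqI)
  interpret M: prob_space M using M by (simp add: is_haar_measure_def borel_probability_def)
  interpret N: prob_space N using N by (simp add: is_haar_measure_def borel_probability_def)
  have sM: "sets M = sets borel" using M by (simp add: is_haar_measure_def borel_probability_def)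
  have sN: "sets N = sets borel" using N by (simp add: is_haar_measure_def borel_probability_def)
  show "sets M = sets N" by (simp add: sM sN)
  have sp: "space M = UNIV" "space N = UNIV"
    using sets_eq_imp_space_eq[OF sM] sets_eq_imp_space_eq[OF sN] by simp_all
  interpret P: pair_sigma_finite N M ..
  fix B assume "B \<in> sets M"
  then have B: "B \<in> sets borel" by (simp add: sM)
  have AEM: "AE x in M. x \<in> \<Sigma>"
    by (rule M.AE_prob_1) (use M in \<open>simp add: is_haar_measure_def measure_def\<close>)
  have AEN: "AE x in N. x \<in> \<Sigma>"
    by (rule N.AE_prob_1) (use N in \<open>simp add: is_haar_measure_def measure_def\<close>)
  have s2: "sets (N \<Otimes>\<^sub>M M) = sets (borel :: ('a config \<times> 'a config) measure)"
    unfolding borel_prod[symmetric] by (rule sets_pair_measure_cong[OF sN sM])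
  have "(\<lambda>(g, x). g \<otimes> x) \<in> borel \<rightarrow>\<^sub>M borel"
    by (rule borel_measurable_continuous_onI[OF continuous_mult])
  then have mult: "(\<lambda>(g, x). g \<otimes> x) \<in> (N \<Otimes>\<^sub>M M) \<rightarrow>\<^sub>M borel"
    by (simp add: measurable_cong_sets[OF s2 refl])
  define f where "f z = (indicator B (case z of (g, x) \<Rightarrow> g \<otimes> x) :: ennreal)" for z
  have f: "f \<in> borel_measurable (N \<Otimes>\<^sub>M M)"
    unfolding f_def by (rule measurable_compose[OF mult]) (use B in simp)
  have vM: "(\<lambda>x. g \<otimes> x) -` B \<in> sets M" and vN: "(\<lambda>x. g \<otimes> x) -` B \<in> sets N" for g
    using measurable_sets[OF translation_measurable[OF sM], of B]
      measurable_sets[OF translation_measurable[OF sN], of B] B by (simp_all add: sM sN sp)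
  have i1: "(\<integral>\<^sup>+x. f (g, x) \<partial>M) = emeasure M ((\<lambda>x. g \<otimes> x) -` B)" for g
    using nn_integral_indicator[OF vM[of g]] by (simp add: f_def indicator_def)
  \<comment> \<open>Commutativity lets the same integrand be read as a translation by x of the
    variable g, so either order of integration meets an invariant measure.\<close>
  have i2: "(\<integral>\<^sup>+g. f (g, x) \<partial>N) = emeasure N ((\<lambda>g. x \<otimes> g) -` B)" for x
    using nn_integral_indicator[OF vN[of x]] by (simp add: f_def indicator_def m_comm[of _ x])
  have "emeasure M B = (\<integral>\<^sup>+g. emeasure M B \<partial>N)"
    by (simp add: N.emeasure_space_1)
  also have "\<dots> = (\<integral>\<^sup>+g. \<integral>\<^sup>+x. f (g, x) \<partial>M \<partial>N)"
    by (rule nn_integral_cong_AE, use AEN in eventually_elim)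
      (simp add: i1 haar_translation_invariant[OF M \<Sigma> _ B])
  also have "\<dots> = (\<integral>\<^sup>+x. \<integral>\<^sup>+g. f (g, x) \<partial>N \<partial>M)"
    by (rule P.Fubini[OF f, symmetric])
  also have "\<dots> = (\<integral>\<^sup>+x. emeasure N B \<partial>M)"
    by (rule nn_integral_cong_AE, use AEM in eventually_elim)
      (simp add: i2 haar_translation_invariant[OF N \<Sigma> _ B])
  also have "\<dots> = emeasure N B" by (simp add: M.emeasure_space_1)
  finally show "emeasure M B = emeasure N B" .
qed

text \<open>A local set is clopen, so its indicator is continuous, and the measures of its
  translates pass to the limit by dominated convergence. Local sets determine the measure.\<close>

lemma invariant_on_closure:
  assumes M: "borel_probability M"
    and H: "\<And>d. d \<in> H \<Longrightarrow> invariant_measure M (\<lambda>x. d \<otimes> x)" and g: "g \<in> closure H"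
  shows "invariant_measure M (\<lambda>x. g \<otimes> x)"
proof -
  interpret prob_space M using M by (simp add: borel_probability_def)
  have s: "sets M = sets borel" using M by (simp add: borel_probability_def)
  have sp: "space M = UNIV" using sets_eq_imp_space_eq[OF s] by simp
  note tm = translation_measurable[OF s]
  have "distr M M (\<lambda>x. g \<otimes> x) = M"
  proof (rule measure_eqI_local)
    show "prob_space (distr M M (\<lambda>x. g \<otimes> x))" by (rule prob_space_distr[OF tm])
    fix n and C :: "'a config set" assume C: "local_on {- int n..int n} C"
    have op: "open C" and cl: "closed C" by (rule open_local_on[OF _ C], simp, rule closed_local_on[OF _ C], simp)
    have Cs: "C \<in> sets M" using op s by auto
    have v: "(\<lambda>x. d \<otimes> x) -` C \<in> sets M" for d using measurable_sets[OF tm Cs] by (simp add: sp)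
    obtain d where d: "\<And>n. d n \<in> H" "d \<longlonglongrightarrow> g" using g by (auto simp: closure_sequential)
    have lim: "(\<lambda>n. indicator ((\<lambda>x. d n \<otimes> x) -` C) x :: real) \<longlonglongrightarrow> indicator ((\<lambda>x. g \<otimes> x) -` C) x" for x
    proof -
      have "(\<lambda>n. (\<lambda>(x, y). x \<otimes> y) (d n, x)) \<longlonglongrightarrow> (\<lambda>(x, y). x \<otimes> y) (g, x)"
        by (rule continuous_on_tendsto_compose[OF continuous_mult])
          (auto intro!: tendsto_Pair d(2))
      then have tend: "(\<lambda>n. d n \<otimes> x) \<longlonglongrightarrow> g \<otimes> x" by simp
      show ?thesis
      proof (cases "g \<otimes> x \<in> C")
        case True
        have "eventually (\<lambda>n. d n \<otimes> x \<in> C) sequentially" by (rule topological_tendstoD[OF tend op True])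
        then show ?thesis
          by (intro tendsto_eventually, elim eventually_mono) (use True in auto)
      next
        case False
        have "eventually (\<lambda>n. d n \<otimes> x \<in> - C) sequentially"
          by (rule topological_tendstoD[OF tend]) (use cl False in auto)
        then show ?thesis
          by (intro tendsto_eventually, elim eventually_mono) (use False in auto)
      qed
    qed
    have "(\<lambda>n. \<integral>x. indicator ((\<lambda>x. d n \<otimes> x) -` C) x \<partial>M) \<longlonglongrightarrow>
        (\<integral>x. (indicator ((\<lambda>x. g \<otimes> x) -` C) x :: real) \<partial>M)"
      by (rule integral_dominated_convergence[where w = "\<lambda>_. 1"])
        (use lim in \<open>auto intro!: borel_measurable_indicator v simp: indicator_le_1\<close>)
    then have "(\<lambda>n. prob ((\<lambda>x. d n \<otimes> x) -` C)) \<longlonglongrightarrow> prob ((\<lambda>x. g \<otimes> x) -` C)"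
      using v by (simp add: sp)
    moreover have "prob ((\<lambda>x. d n \<otimes> x) -` C) = prob C" for n
      using H[OF d(1)[of n]] Cs by (simp add: invariant_measure_def measure_def sp)
    ultimately have "prob ((\<lambda>x. g \<otimes> x) -` C) = prob C"
      by (simp add: LIMSEQ_const_iff)
    then show "measure (distr M M (\<lambda>x. g \<otimes> x)) C = measure M C"
      by (simp add: measure_distr[OF tm Cs] sp)
  qed (simp_all add: s prob_space_axioms)
  then show ?thesis
    unfolding invariant_measure_def by (metis emeasure_distr tm)
qed

lemma eq_haar_measureI:
  assumes M: "borel_probability M" "emeasure M \<Sigma> = 1" and \<Sigma>: "subgroup \<Sigma> G" "closed \<Sigma>"
    and inv: "\<And>g. g \<in> \<Sigma> \<Longrightarrow> invariant_measure M (\<lambda>x. g \<otimes> x)"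
  shows "M = haar_measure G \<Sigma>"
proof -
  have s: "sets M = sets borel" using M by (simp add: borel_probability_def)
  have sp: "space M = UNIV" using sets_eq_imp_space_eq[OF s] by simp
  have "is_haar_measure G \<Sigma> M"
    unfolding is_haar_measure_def translation_image
    using M inv[OF subgroup.m_inv_closed[OF \<Sigma>(1)]] by (simp add: invariant_measure_def s sp)
  then show ?thesis
    unfolding haar_measure_def using haar_unique[OF _ _ \<Sigma>] by (metis the_equality)
qed

end

section \<open>Rigidity\<close>

locale algebraic_measure = algebraic_rule G F r s + bipermutative_measure F r s M
  for G :: "'a::finite config monoid" (structure) and F r s M +
  assumes F_continuous: "continuous_on UNIV F"
begin

section \<open>Translations that preserve the measure\<close>

abbreviation stable :: "'a config \<Rightarrow> bool" where
  "stable d \<equiv> invariant_measure M (\<lambda>x. d \<otimes> x)"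

lemma translation_measurable_M: "(\<lambda>x. d \<otimes> x) \<in> M \<rightarrow>\<^sub>M M"
  by (rule translation_measurable[OF sets_M])

lemma translation_vimage_sets: "B \<in> sets M \<Longrightarrow> (\<lambda>x. d \<otimes> x) -` B \<in> sets M"
  using measurable_sets[OF translation_measurable_M, of B d] by simp

lemma stableD: "stable d \<Longrightarrow> B \<in> sets M \<Longrightarrow> emeasure M ((\<lambda>x. d \<otimes> x) -` B) = emeasure M B"
  by (simp add: invariant_measure_def)

lemma stableI: "(\<And>B. B \<in> sets M \<Longrightarrow> emeasure M ((\<lambda>x. d \<otimes> x) -` B) = emeasure M B) \<Longrightarrow> stable d"
  by (simp add: invariant_measure_def)

lemma stable_one: "stable \<one>"
  by (rule stableI) simp

lemma stable_mult:
  assumes "stable d" "stable e" shows "stable (d \<otimes> e)"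
proof (rule stableI)
  fix B assume B: "B \<in> sets M"
  have "(\<lambda>x. d \<otimes> e \<otimes> x) -` B = (\<lambda>x. e \<otimes> x) -` ((\<lambda>x. d \<otimes> x) -` B)"
    by (auto simp: m_assoc)
  then show "emeasure M ((\<lambda>x. d \<otimes> e \<otimes> x) -` B) = emeasure M B"
    using assms B by (simp add: stableD translation_vimage_sets)
qed

lemma stable_inv:
  assumes "stable d" shows "stable (inv d)"
proof (rule stableI)
  fix B assume B: "B \<in> sets M"
  have "(\<lambda>x. d \<otimes> x) -` ((\<lambda>x. inv d \<otimes> x) -` B) = B"
    by (auto simp: m_assoc[symmetric])
  then show "emeasure M ((\<lambda>x. inv d \<otimes> x) -` B) = emeasure M B"
    using stableD[OF assms translation_vimage_sets[OF B, of "inv d"]] by simp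
qed

text \<open>\<open>h\<close> intertwines translation by d with translation by h d. Used for the
  shift and for \<open>F\<close>, it makes the stable elements an invariant set.\<close>

lemma stable_image:
  assumes d: "stable d" and h: "measure_preserving M h" "h \<in> hom G G"
  shows "stable (h d)"
proof (rule stableI)
  interpret h: measure_preserving M h by fact
  fix B assume B: "B \<in> sets M"
  have hB: "h -` A \<in> sets M" "emeasure M (h -` A) = emeasure M A" if "A \<in> sets M" for A
    using measurable_sets[OF h.T_measurable that] h.T_invariant that
    by (auto simp: invariant_measure_def)
  have "h -` ((\<lambda>x. h d \<otimes> x) -` B) = (\<lambda>x. d \<otimes> x) -` (h -` B)"
    by (auto simp: hom_mult_eq[OF h(2)])
  then show "emeasure M ((\<lambda>x. h d \<otimes> x) -` B) = emeasure M B"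
    using hB(2)[OF translation_vimage_sets[OF B, of "h d"]] stableD[OF d hB(1)[OF B]] hB(2)[OF B]
    by simp
qed

lemma ergodic_shift_power:
  assumes erg: "ergodic M shift_map"
    and inv: "invariant_sets_mod M shift_map =
      invariant_sets_mod M (shift_map ^^ (k * kernel_period G F))"
    and primes: "\<And>p. prime p \<Longrightarrow> p dvd CARD('a) \<Longrightarrow> p dvd k"
  shows "ergodic M (shift_map ^^ (kernel_period G F * (CARD('a) ^ nat (s - r)) ^ n))"
proof -
  let ?N = "kernel_period G F * (CARD('a) ^ nat (s - r)) ^ n"
  have "?N > 0" using kernel_period_props(1) by simp
  moreover have "invariant_sets_mod M (shift_map ^^ l) \<subseteq> invariant_sets_mod M shift_map"
    if l: "prime l" "l dvd ?N" for l
  proof -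
    \<comment> \<open>A prime factor of the exponent divides p1 or the alphabet size, hence k p1; so
      sets invariant for the power l are invariant for k p1, where hypothesis 2 applies.\<close>
    have "l dvd kernel_period G F \<or> l dvd CARD('a)"
      using l prime_dvd_mult_iff prime_dvd_power by metis
    then have "l dvd k * kernel_period G F" using primes[OF l(1)] by auto
    then obtain j where "k * kernel_period G F = l * j" by blast
    then show ?thesis using shift.invariant_sets_mod_mult[of l j] inv by simp
  qed
  ultimately have "prob B = 0 \<or> prob B = 1" if B: "B \<in> sets M" "(shift_map ^^ ?N) -` B = B" for B
  proof (rule shift.ergodic_power[OF erg _ _ B(1)])
    have "(shift_map ^^ ?N) x \<in> B \<longleftrightarrow> x \<in> B" for x using B(2) by blast
    then show "AE x in M. (shift_map ^^ ?N) x \<in> B \<longleftrightarrow> x \<in> B" by (intro AE_I2)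
  qed
  then show ?thesis by (auto simp: ergodic_def emeasure_eq_measure)
qed

lemma stable_or_singular:
  assumes erg: "ergodic M shift_map"
    and inv: "invariant_sets_mod M shift_map =
      invariant_sets_mod M (shift_map ^^ (k * kernel_period G F))"
    and primes: "\<And>p. prime p \<Longrightarrow> p dvd CARD('a) \<Longrightarrow> p dvd k"
    and d: "d \<in> K (Suc n)"
  shows "stable d \<or> (\<exists>E\<in>sets M. emeasure M E = 1 \<and> emeasure M ((\<lambda>x. d \<otimes> x) -` E) = 0)"
proof -
  define P where "P = kernel_period G F * (CARD('a) ^ nat (s - r)) ^ n"
  define T where "T = (shift_map :: 'a config \<Rightarrow> _) ^^ P"
  define S where "S = (unshift_map :: 'a config \<Rightarrow> _) ^^ P"
  define N where "N = distr M M (\<lambda>x. d \<otimes> x)"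
  \<comment> \<open>\<open>T\<close> is a homomorphism that fixes d, hence commutes with the
    translation; through this identity \<open>N\<close> inherits invariance and ergodicity from
    \<open>M\<close>.\<close>
  have Td: "T (d \<otimes> x) = d \<otimes> T x" for x
    using shift_period_K[OF d] by (simp add: T_def P_def hom_mult_eq[OF hom_funpow[OF shift_hom]])
  have N: "emeasure N B = emeasure M ((\<lambda>x. d \<otimes> x) -` B)" if "B \<in> sets M" for B
    using that by (simp add: N_def emeasure_distr[OF translation_measurable_M])
  have setsN: "sets N = sets M" and spN: "space N = UNIV" by (simp_all add: N_def)
  have mpM: "measure_preserving M T" unfolding T_def by (rule shift.measure_preserving_power)
  then interpret T: measure_preserving M T .
  have ergM: "ergodic M T"
    unfolding T_def P_def by (rule ergodic_shift_power[OF erg inv primes])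
  have TB: "T -` B \<in> sets M" "emeasure M (T -` B) = emeasure M B" if "B \<in> sets M" for B
    using measurable_sets[OF T.T_measurable that] T.T_invariant that
    by (auto simp: invariant_measure_def)
  have Td_vimage: "T -` ((\<lambda>x. d \<otimes> x) -` B) = (\<lambda>x. d \<otimes> x) -` (T -` B)" for B
    by (auto simp: Td)
  have mpN: "measure_preserving N T"
  proof (intro measure_preserving.intro measure_preserving_axioms.intro)
    show "prob_space N" unfolding N_def by (rule prob_space_distr[OF translation_measurable_M])
    show "T \<in> N \<rightarrow>\<^sub>M N" using T.T_measurable by (simp add: measurable_cong_sets[OF setsN setsN])
    show "invariant_measure N T"
      using TB translation_vimage_sets
      by (simp add: invariant_measure_def setsN spN N Td_vimage[symmetric])
  qed
  have ergN: "ergodic N T"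
    unfolding ergodic_def
  proof (intro ballI impI)
    fix B assume "B \<in> sets N" and inv: "T -` B \<inter> space N = B"
    then have B: "B \<in> sets M" by (simp add: setsN)
    have "T -` ((\<lambda>x. d \<otimes> x) -` B) \<inter> space M = (\<lambda>x. d \<otimes> x) -` B"
      using inv by (simp add: Td_vimage spN)
    then show "emeasure N B = 0 \<or> emeasure N B = 1"
      using ergM translation_vimage_sets[OF B] by (simp add: ergodic_def N[OF B])
  qed
  have unshift: "unshift_map \<in> M \<rightarrow>\<^sub>M M"
    using borel_measurable_continuous_onI[OF continuous_on_unshift_map]
    by (simp add: measurable_cong_sets[OF sets_M sets_M])
  have S: "S \<in> M \<rightarrow>\<^sub>M M" unfolding S_def by (rule measurable_compose_n[OF unshift])
  have "(shift_map ^^ j) ((unshift_map ^^ j) x) = x \<and> (unshift_map ^^ j) ((shift_map ^^ j) x) = x"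
    for j and x :: "'a config"
    by (induction j arbitrary: x) (simp_all add: funpow_swap1[of shift_map] funpow_swap1[of unshift_map])
  then have "T (S x) = x" "S (T x) = x" for x by (simp_all add: T_def S_def)
  from invariant_measures_eq_or_singular[OF mpM mpN setsN space_M S this ergM ergN]
  show ?thesis
  proof
    assume eq: "M = N"
    have "stable d" by (rule stableI) (use N eq in simp)
    then show ?thesis ..
  next
    assume "\<exists>E\<in>sets M. emeasure M E = 1 \<and> emeasure N E = 0"
    then show ?thesis using N by auto
  qed
qed

text \<open>Off a null set, the fibres of \<open>F ^^ Suc n\<close> coincide with those of \<open>F ^^ n\<close>; as \<open>F ^^ n\<close>
  preserves \<open>M\<close>, this makes \<open>F\<close> injective modulo \<open>M\<close>.\<close>

lemma nearly_injective:
  assumes sing: "\<And>d. d \<in> K (Suc n) - K n \<Longrightarrow>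
      \<exists>E\<in>sets M. emeasure M E = 1 \<and> emeasure M ((\<lambda>x. d \<otimes> x) -` E) = 0"
    and e: "e > 0"
  shows "\<exists>C\<in>sets M. measure M (sym_diff (F -` C) {x. x 0 = c}) < e"
proof -
  define D where "D = K (Suc n) - K n"
  have "finite D" unfolding D_def using finite_K by blast
  obtain E where E: "\<And>d. d \<in> D \<Longrightarrow> E d \<in> sets M" "\<And>d. d \<in> D \<Longrightarrow> emeasure M (E d) = 1"
    "\<And>d. d \<in> D \<Longrightarrow> emeasure M ((\<lambda>x. d \<otimes> x) -` E d) = 0"
    using sing unfolding D_def by metis
  \<comment> \<open>Outside \<open>Z\<close> a point lies in every \<open>E d\<close> while its
    translate by d does not. So two points outside \<open>Z\<close> never differ by an element of
    \<open>D\<close>.\<close>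
  define Z where "Z = (\<Union>d\<in>D. (UNIV - E d) \<union> (\<lambda>x. d \<otimes> x) -` E d)"
  have "(UNIV - E d) \<union> (\<lambda>x. d \<otimes> x) -` E d \<in> null_sets M" if "d \<in> D" for d
  proof (rule null_sets.Un)
    have "emeasure M (space M - E d) = emeasure M (space M) - emeasure M (E d)"
      using E[OF that] by (intro emeasure_compl) auto
    then have "emeasure M (space M - E d) = 0" using E(2)[OF that] emeasure_space_1 by simp
    moreover have "space M - E d \<in> sets M" using E(1)[OF that] by blast
    ultimately show "UNIV - E d \<in> null_sets M" by (simp add: null_sets_def)
    show "(\<lambda>x. d \<otimes> x) -` E d \<in> null_sets M"
      using E(3)[OF that] translation_vimage_sets[OF E(1)[OF that]] by (simp add: null_sets_def)
  qed
  then have Z: "Z \<in> null_sets M"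
    unfolding Z_def using \<open>finite D\<close> by (intro null_sets.finite_UN) auto
  define A where "A = space M - Z"
  have As: "A \<in> sets M" unfolding A_def by (intro sets.Diff sets.top null_setsD2[OF Z])
  have fibre: "(F ^^ n) x = (F ^^ n) y" if x: "x \<in> A" and y: "y \<in> A"
    and eq: "(F ^^ Suc n) x = (F ^^ Suc n) y" for x y
  proof -
    define d where "d = y \<otimes> inv x"
    have yd: "y = d \<otimes> x" by (simp add: d_def m_assoc)
    note hn = hom_funpow[OF F_hom]
    have "(F ^^ Suc n) d = \<one>"
      unfolding d_def using eq by (simp only: hom_mult_eq[OF hn] hom_inv_eq[OF hn]) simp
    then have "d \<in> K (Suc n)" by (simp only: K_iff)
    moreover have "d \<notin> D"
    proof
      assume "d \<in> D"
      then have "y \<in> E d" "d \<otimes> x \<notin> E d" using x y by (auto simp: A_def Z_def)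
      then show False using yd by simp
    qed
    ultimately have "(F ^^ n) d = \<one>" by (simp add: D_def K_iff)
    then show ?thesis using hom_mult_eq[OF hn, of n d x] yd by simp
  qed
  have "emeasure M A = emeasure M (space M)" unfolding A_def by (rule emeasure_Diff_null_set[OF Z]) simp
  then have "emeasure M A = 1" using emeasure_space_1 by simp
  \<comment> \<open>Images of Borel sets under \<open>F\<close> need not be Borel. Shrinking
    \<open>A\<close> to a compact \<open>C\<close> of measure above 1 - e makes the image
    \<open>C'\<close> compact.\<close>
  moreover have "emeasure M A = (SUP C\<in>{C. C \<subseteq> A \<and> compact C}. emeasure M C)"
    by (rule inner_regular[OF sets_M]) (use As sets_M in auto)
  ultimately have "ennreal (1 - e) < (SUP C\<in>{C. C \<subseteq> A \<and> compact C}. emeasure M C)"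
    using e ennreal_lessI[of 1 "1 - e"] by simp
  then obtain C where C: "C \<subseteq> A" "compact C" "ennreal (1 - e) < emeasure M C"
    by (auto simp: less_SUP_iff)
  have Cs: "C \<in> sets M" using compact_imp_closed[OF C(2)] sets_M by auto
  have "1 - e < prob C"
    using C(3) ennreal_leI[of "prob C" "1 - e"] by (auto simp: emeasure_eq_measure not_le[symmetric])
  then have C_compl: "prob (space M - C) < e" using prob_compl[OF Cs] by simp
  have cont: "continuous_on UNIV (F ^^ j)" for j
  proof (induction j)
    case (Suc j)
    then show ?case using continuous_on_compose2[OF F_continuous Suc] by (simp add: comp_def)
  qed (simp add: continuous_on_id)
  define B where "B = {x :: 'a config. x 0 = c}"
  have "open (- B)" using open_coordinate[of "\<lambda>a. a \<noteq> c" 0] by (simp add: B_def Collect_neg_eq)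
  then have "closed B" by (simp add: closed_def)
  then have "closed ((F ^^ n) -` B)" using cont by (simp add: continuous_closed_vimage continuous_on_eq_continuous_at)
  then have "compact (C \<inter> (F ^^ n) -` B)" using C(2) by (intro compact_Int_closed)
  define C' where "C' = (F ^^ Suc n) ` (C \<inter> (F ^^ n) -` B)"
  have "compact C'" unfolding C'_def
    by (rule compact_continuous_image[OF continuous_on_subset[OF cont]]) (use \<open>compact (C \<inter> _)\<close> in auto)
  from compact_imp_closed[OF this] have C's: "C' \<in> sets M" using sets_M by auto
  have Bs: "B \<in> sets M" using \<open>closed B\<close> sets_M by auto
  have FC': "F -` C' \<in> sets M" using measurable_sets[OF T_measurable C's] by simp
  let ?D = "sym_diff (F -` C') B"
  have Ds: "?D \<in> sets M" by (intro sets.Un sets.Diff FC' Bs)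
  \<comment> \<open>The error is measured after pulling back by \<open>F ^^ n\<close>, which
    preserves the measure. On \<open>C\<close> the fibres agree, so there
    \<open>(F ^^ Suc n) x\<close> lies in \<open>C'\<close> exactly if \<open>(F ^^ n) x\<close>
    lies in \<open>B\<close>.\<close>
  have "(F ^^ n) -` ?D \<subseteq> space M - C"
  proof
    fix x assume x: "x \<in> (F ^^ n) -` ?D"
    have "x \<notin> C"
    proof
      assume xC: "x \<in> C"
      show False
      proof (cases "(F ^^ n) x \<in> B")
        case True
        then have "(F ^^ Suc n) x \<in> C'" unfolding C'_def using xC by blast
        then show False using x True by simp
      next
        case False
        then have "(F ^^ Suc n) x \<in> C'" using x by simp
        then obtain y where y: "y \<in> C" "(F ^^ n) y \<in> B" "(F ^^ Suc n) x = (F ^^ Suc n) y"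
          unfolding C'_def by blast
        have "(F ^^ n) x = (F ^^ n) y" by (rule fibre[OF _ _ y(3)]) (use xC y(1) C(1) in auto)
        then show False using False y(2) by simp
      qed
    qed
    then show "x \<in> space M - C" by simp
  qed
  then have "prob ((F ^^ n) -` ?D) \<le> prob (space M - C)"
    by (rule finite_measure_mono) (use Cs in blast)
  then have "prob ?D < e" using prob_vimage_Tn[OF Ds, of n] C_compl by simp
  then show ?thesis using C's unfolding B_def by blast
qed

theorem eq_haar_measure:
  assumes erg: "ergodic M shift_map"
    and inv: "invariant_sets_mod M shift_map =
      invariant_sets_mod M (shift_map ^^ (k * kernel_period G F))"
    and primes: "\<And>p. prime p \<Longrightarrow> p dvd CARD('a) \<Longrightarrow> p dvd k"
    and \<Sigma>: "subgroup \<Sigma> G" "closed \<Sigma>" and M\<Sigma>: "emeasure M \<Sigma> = 1"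
    and entropy: "KS_entropy M F > 0"
    and dense: "\<And>\<Gamma>. subgroup \<Gamma> G \<Longrightarrow> \<Gamma> \<subseteq> D_infty G F \<Sigma> \<Longrightarrow> invariant_set F \<Gamma> \<Longrightarrow> infinite \<Gamma> \<Longrightarrow>
           \<Sigma> \<subseteq> closure \<Gamma>"
  shows "M = haar_measure G \<Sigma>"
proof -
  have bp: "borel_probability M" by (simp add: borel_probability_def prob_space_axioms sets_M)
  define H where "H = {d. (\<exists>n. d \<in> K n) \<and> stable d}"
  have sub: "subgroup H G"
  proof (rule subgroupI)
    have "\<one> \<in> K 0" by (simp add: K_iff)
    then show "H \<noteq> {}" unfolding H_def using stable_one by blast
    fix a assume a: "a \<in> H"
    then obtain n where n: "a \<in> K n" by (auto simp: H_def)
    show "inv a \<in> H"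
      using subgroup.m_inv_closed[OF subgroup_K n] stable_inv[of a] a unfolding H_def by blast
    fix b assume b: "b \<in> H"
    then obtain m where "b \<in> K m" by (auto simp: H_def)
    then have "a \<in> K (max n m)" "b \<in> K (max n m)" using n K_mono[of n "max n m"] K_mono[of m "max n m"] by auto
    then have "a \<otimes> b \<in> K (max n m)" using subgroup.m_closed[OF subgroup_K] by blast
    then show "a \<otimes> b \<in> H" using stable_mult a b unfolding H_def by blast
  qed auto
  have "H \<subseteq> \<Sigma>"
  proof
    fix d assume "d \<in> H"
    then have "stable d" by (simp add: H_def)
    have \<Sigma>s: "\<Sigma> \<in> sets M" using \<Sigma>(2) sets_M by auto
    have "emeasure M ((\<lambda>x. d \<otimes> x) -` \<Sigma>) = 1" using stableD[OF \<open>stable d\<close> \<Sigma>s] M\<Sigma> by simp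
    then have "AE x in M. x \<in> (\<lambda>x. d \<otimes> x) -` \<Sigma>" by (intro AE_prob_1) (simp add: measure_def)
    moreover have "AE x in M. x \<in> \<Sigma>" by (rule AE_prob_1) (use M\<Sigma> in \<open>simp add: measure_def\<close>)
    \<comment> \<open>Almost every x has both x and its translate in \<Sigma>, which puts d in
      \<Sigma>; a constant statement that holds almost everywhere for a probability measure is
      true.\<close>
    ultimately have "AE x in M. d \<in> \<Sigma>"
    proof eventually_elim
      case (elim x)
      then have "(d \<otimes> x) \<otimes> inv x \<in> \<Sigma>"
        using subgroup.m_closed[OF \<Sigma>(1)] subgroup.m_inv_closed[OF \<Sigma>(1)] by simp
      then show ?case by (simp add: m_assoc)
    qed
    then show "d \<in> \<Sigma>" by simp
  qed
  then have H_D: "H \<subseteq> D_infty G F \<Sigma>" by (auto simp: H_def D_infty_def K_def)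
  have shift_H: "shift_map d \<in> H" if "d \<in> H" for d
    using that stable_image[OF _ shift.measure_preserving_axioms shift_hom] shift_power_K[of d _ 1]
    by (auto simp: H_def)
  have F_H: "F d \<in> H" if "d \<in> H" for d
  proof -
    obtain n where "d \<in> K n" using \<open>d \<in> H\<close> by (auto simp: H_def)
    then have "d \<in> K (Suc n)" using K_mono[of n "Suc n"] by auto
    then have "F d \<in> K n" by (simp add: K_Suc_iff)
    then show ?thesis using that stable_image[OF _ measure_preserving_axioms F_hom] by (auto simp: H_def)
  qed
  have inv_H: "invariant_set F H"
    unfolding invariant_set_def
  proof (intro conjI equalityI subsetI)
    fix d assume d: "d \<in> H"
    obtain n where "d \<in> K n" using d by (auto simp: H_def)
    then have "d \<in> K (Suc n)" using K_mono[of n "Suc n"] by auto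
    \<comment> \<open>Periodicity supplies preimages under the shift inside \<open>H\<close>: d is
      the shift of its own iterate of order P - 1.\<close>
    from shift_period_K[OF this] obtain P where "(shift_map ^^ P) d = d" "P > 0"
      using kernel_period_props(1) by auto
    then have "shift_map ((shift_map ^^ (P - 1)) d) = d" by (cases P) auto
    moreover have "(shift_map ^^ j) d \<in> H" for j by (induction j) (use d shift_H in auto)
    ultimately show "d \<in> shift_map ` H" by (metis imageI)
  qed (use shift_H F_H in auto)
  have "infinite H"
  proof
    assume fin: "finite H"
    have "\<forall>d\<in>H. \<exists>n. d \<in> K n" by (simp add: H_def)
    then obtain m where m: "\<And>d. d \<in> H \<Longrightarrow> d \<in> K (m d)" by metis
    define n where "n = Max (insert 0 (m ` H))"
    have "d \<in> K n" if "d \<in> H" for d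
    proof -
      have "m d \<le> n" unfolding n_def using fin that by (intro Max_ge) auto
      then show ?thesis using m[OF that] K_mono by blast
    qed
    then have "\<exists>E\<in>sets M. emeasure M E = 1 \<and> emeasure M ((\<lambda>x. d \<otimes> x) -` E) = 0"
      if "d \<in> K (Suc n) - K n" for d
      using stable_or_singular[OF erg inv primes, of d n] that by (auto simp: H_def)
    then have "KS_entropy M F \<le> 0"
      by (intro KS_entropy_nonpos allI impI nearly_injective)
    then show False using entropy by simp
  qed
  from dense[OF sub H_D inv_H this] have cl: "\<Sigma> \<subseteq> closure H" .
  show ?thesis
    by (rule eq_haar_measureI[OF bp M\<Sigma> \<Sigma>], rule invariant_on_closure[OF bp, of H])
      (use cl in \<open>auto simp: H_def\<close>)
qed

end

theorem theorem3p4: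
  fixes G :: "'a::finite config monoid"
    and F :: "'a config \<Rightarrow> 'a config"
    and \<Sigma> :: "'a config set"
    and k :: nat
    and \<mu> :: "'a config measure"
  assumes "abelian_group_shift G"
    and "algebraic_CA G F"
    and "bipermutative F"
    and "\<not> trivial_CA F"
    and "subgroup \<Sigma> G" and "closed \<Sigma>" and "invariant_set F \<Sigma>"
    and "\<And>p. prime p \<Longrightarrow> p dvd CARD('a) \<Longrightarrow> p dvd k"
    and "borel_probability \<mu>"
    and "invariant_measure \<mu> F" and "invariant_measure \<mu> shift_map"
    and "measure_support \<mu> \<subseteq> \<Sigma>"
    and "ergodic \<mu> shift_map"
    and "invariant_sets_mod \<mu> shift_map = invariant_sets_mod \<mu> (shift_map ^^ (k * kernel_period G F))"
    and "KS_entropy \<mu> F > 0"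
    and "\<And>\<Gamma>. subgroup \<Gamma> G \<Longrightarrow> \<Gamma> \<subseteq> D_infty G F \<Sigma> \<Longrightarrow> invariant_set F \<Gamma> \<Longrightarrow> infinite \<Gamma> \<Longrightarrow>
           \<Sigma> \<subseteq> closure \<Gamma>"
  shows "\<mu> = haar_measure G \<Sigma>"
proof -
  obtain r s where rule: "bipermutative_rule F r s"
    using bipermutative_rule_exists[OF assms(3,4)] by blast
  have G: "comm_group G" "carrier G = UNIV" "continuous_on UNIV (\<lambda>(x, y). x \<otimes>\<^bsub>G\<^esub> y)"
    "continuous_on UNIV (shift_map :: 'a config \<Rightarrow> _)" "shift_map \<in> hom G G"
    using assms(1) by (simp_all add: abelian_group_shift_def)
  have F: "continuous_on UNIV F" "\<And>x. F (shift_map x) = shift_map (F x)" "F \<in> hom G G"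
    using assms(2) by (simp_all add: algebraic_CA_def cellular_automaton_def)
  have \<mu>: "prob_space \<mu>" "sets \<mu> = sets borel"
    using assms(9) by (simp_all add: borel_probability_def)
  have mp: "measure_preserving \<mu> h" if "continuous_on UNIV h" "invariant_measure \<mu> h" for h
  proof (intro measure_preserving.intro measure_preserving_axioms.intro \<mu>(1) that(2))
    show "h \<in> \<mu> \<rightarrow>\<^sub>M \<mu>"
      using borel_measurable_continuous_onI[OF that(1)] by (simp add: measurable_cong_sets[OF \<mu>(2) \<mu>(2)])
  qed
  interpret algebraic_measure G F r s \<mu>
    by (intro algebraic_measure.intro algebraic_rule.intro algebraic_rule_axioms.intro
        bipermutative_measure.intro bipermutative_measure_axioms.intro algebraic_measure_axioms.intro
        rule G F \<mu> mp assms)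
  show ?thesis
    by (rule eq_haar_measure[OF assms(13,14,8,5,6) measure_support_subset_closed[OF assms(9,6,12)]
          assms(15,16)])
qed

end
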